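(* Let $F\in\mathcal F$ with $F=O(|\mathbf x|^{-3-\epsilon})$ as $|\mathbf x|\to+\infty$ for some $\epsilon>0$, and let $s_1,s_2>0$. Then $$\mathrm{Pf}_{s_1,s_2}\int d^3\mathbf x\,F=\mathrm{Pf}_{s_1}\Bigl\{\mathop{\mathrm{FP}}_{B\to0}\int d^3\mathbf r_1\Bigl(\frac{r_1}{s_2}\Bigr)^{B}\Bigl[F-\sum_{b+3\le0}r_2^b\,{}_2f_b(\mathbf n_2)\Bigr]\Bigr\},$$ where the ${}_2f_b$ are the coefficients of the expansion of $F$ as $r_2\to0$ and $\mathbf r_1=\mathbf x-\mathbf y_1$ is the integration variable.
   Context: Fix two distinct points $\mathbf y_1,\mathbf y_2\in\mathbb R^3$. For $\mathbf x\in\mathbb R^3$ put $r_1=|\mathbf x-\mathbf y_1|$, $\mathbf n_1=(\mathbf x-\mathbf y_1)/r_1$, $r_2=|\mathbf x-\mathbf y_2|$, $\mathbf n_2=(\mathbf x-\mathbf y_2)/r_2$; $d\Omega_1$, $d\Omega_2$ are the solid angle elements of $\mathbf n_1$, $\mathbf n_2$. Class $\mathcal F$: real functions $F$, smooth on $\mathbb R^3\setminus\{\mathbf y_1,\mathbf y_2\}$, for which there are real exponents $a_0<a_1<a_2<\cdots$ (only finitely many below any bound) and functions ${}_1f_{a}$ on the unit sphere such that for all $N\in\mathbb N$, $F=\sum_{a\le N}r_1^{a}\,{}_1f_{a}(\mathbf n_1)+o(r_1^N)$ as $r_1\to0$ (uniformly in $\mathbf n_1$); and similarly at $\mathbf y_2$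 with exponents $b$ and coefficients ${}_2f_b(\mathbf n_2)$. Put ${}_1f_a=0$ if $a$ is not one of the exponents (same for 2). Partie finie of an integral: with $\mathcal B_{1}(s),\mathcal B_2(s)$ the closed balls of radius $s$ centred at $\mathbf y_{1},\mathbf y_2$, $$\mathrm{Pf}_{s_1,s_2}\int d^3\mathbf x\,F=\lim_{s\to0}\Bigl\{\int_{\mathbb R^3\setminus\mathcal B_1(s)\cup\mathcal B_2(s)}d^3\mathbf x\,F+\sum_{a+3<0}\frac{s^{a+3}}{a+3}\int d\Omega_1\,{}_1f_a+\ln\Bigl(\frac s{s_1}\Bigr)\int d\Omega_1\,{}_1f_{-3}+\sum_{b+3<0}\frac{s^{b+3}}{b+3}\int d\Omega_2\,{}_2f_b+\ln\Bigl(\frac s{s_2}\Bigr)\int d\Omega_2\,{}_2f_{-3}\Bigr\}.$$ Right-hand side: write $\widetilde F_2=F-\sum_{b+3\le0}r_2^b\,{}_2f_b(\mathbf n_2)$, which is locally integrable near $\mathbf y_2$ and whose singular coefficients at $\mathbf y_1$ of order $a\le-3$ are the ${}_1f_a$ of $F$. Then $$\mathrm{Pf}_{s_1}\Bigl\{\mathop{\mathrm{FP}}_{B\to0}\int d^3\mathbf r_1\Bigl(\tfrac{r_1}{s_2}\Bigr)^{B}\widetilde F_2\Bigr\}=\lim_{s\to0}\Bigl\{\mathop{\mathrm{FP}}_{B\to0}\int_{r_1>s}d^3\mathbf r_1\Bigl(\tfrac{r_1}{s_2}\Bigr)^{B}\widetilde F_2+\sum_{a+3<0}\frac{s^{a+3}}{a+3}\int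 d\Omega_1\,{}_1f_a+\ln\Bigl(\frac s{s_1}\Bigr)\int d\Omega_1\,{}_1f_{-3}\Bigr\},$$ where $\mathrm{FP}_{B\to0}$ is the coefficient of $B^0$ in the Laurent expansion at $B=0$ of the analytic continuation in $B\in\mathbb C$ of the integral, which converges at infinity for $\Re(B)<0$. *)

theory Defs
  imports "HOL-Complex_Analysis.Complex_Analysis"
begin

fun Ck_on :: "nat \<Rightarrow> (real^3) set \<Rightarrow> (real^3 \<Rightarrow> real) \<Rightarrow> bool" where
  "Ck_on 0 S F \<longleftrightarrow> continuous_on S F"
| "Ck_on (Suc k) S F \<longleftrightarrow>
     (\<forall>x\<in>S. F differentiable (at x)) \<and>
     (\<forall>v. Ck_on k S (\<lambda>x. frechet_derivative F (at x) v))"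

definition smooth_on :: "(real^3) set \<Rightarrow> (real^3 \<Rightarrow> real) \<Rightarrow> bool" where
  "smooth_on S F \<longleftrightarrow> (\<forall>k. Ck_on k S F)"

(* A is the set of exponents. Being finite below every bound, it is either finite or the range of
   a strictly increasing sequence; the finite case is a sequence padded with zero coefficients.
   Only the values of f a on the unit sphere matter. *)
definition has_radial_expansion ::
    "(real^3 \<Rightarrow> real) \<Rightarrow> real^3 \<Rightarrow> real set \<Rightarrow> (real \<Rightarrow> real^3 \<Rightarrow> real) \<Rightarrow> bool" where
  "has_radial_expansion F y A f \<longleftrightarrow>
     (\<forall>c. finite {a\<in>A. a \<le> c}) \<and>
     (\<forall>a. a \<notin> A \<longrightarrow> (\<forall>n\<in>sphere 0 1. f a n = 0)) \<and>
     (\<forall>N::nat. uniform_limit (sphere 0 1)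
        (\<lambda>r n. (F (y + r *\<^sub>R n) - (\<Sum>a\<in>{a\<in>A. a \<le> real N}. r powr a * f a n)) / r ^ N)
        (\<lambda>n. 0) (at_right 0))"

definition class_F ::
    "real^3 \<Rightarrow> real^3 \<Rightarrow> real set \<Rightarrow> (real \<Rightarrow> real^3 \<Rightarrow> real) \<Rightarrow>
     real set \<Rightarrow> (real \<Rightarrow> real^3 \<Rightarrow> real) \<Rightarrow> (real^3 \<Rightarrow> real) \<Rightarrow> bool" where
  "class_F y1 y2 A1 f1 A2 f2 F \<longleftrightarrow>
     smooth_on (- {y1, y2}) F \<and>
     has_radial_expansion F y1 A1 f1 \<and>
     has_radial_expansion F y2 A2 f2"

(* Integral against the solid angle element sin \<theta> d\<theta> d\<phi>. *)
definition solid_angle_integral :: "(real^3 \<Rightarrow> real) \<Rightarrow> real" where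
  "solid_angle_integral g =
     (LINT p : {0..pi} \<times> {0..2 * pi} | lborel.
        g (vector [sin (fst p) * cos (snd p), sin (fst p) * sin (snd p), cos (fst p)])
          * sin (fst p))"

definition Pf_counterterm ::
    "real set \<Rightarrow> (real \<Rightarrow> real^3 \<Rightarrow> real) \<Rightarrow> real \<Rightarrow> real \<Rightarrow> real" where
  "Pf_counterterm A f \<sigma> s =
     (\<Sum>a\<in>{a\<in>A. a + 3 < 0}. s powr (a + 3) / (a + 3) * solid_angle_integral (f a))
     + ln (s / \<sigma>) * solid_angle_integral (f (-3))"

definition has_Pf ::
    "real^3 \<Rightarrow> real^3 \<Rightarrow> real set \<Rightarrow> (real \<Rightarrow> real^3 \<Rightarrow> real) \<Rightarrow>
     real set \<Rightarrow> (real \<Rightarrow> real^3 \<Rightarrow> real) \<Rightarrow> real \<Rightarrow> real \<Rightarrow> (real^3 \<Rightarrow> real) \<Rightarrow> real \<Rightarrow> bool" where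
  "has_Pf y1 y2 A1 f1 A2 f2 s1 s2 F L \<longleftrightarrow>
     (\<forall>s>0. set_integrable lborel (- (cball y1 s \<union> cball y2 s)) F) \<and>
     ((\<lambda>s. (LINT x : - (cball y1 s \<union> cball y2 s) | lborel. F x)
           + Pf_counterterm A1 f1 s1 s + Pf_counterterm A2 f2 s2 s) \<longlongrightarrow> L) (at_right 0)"

definition subtract_singular ::
    "real^3 \<Rightarrow> real set \<Rightarrow> (real \<Rightarrow> real^3 \<Rightarrow> real) \<Rightarrow> (real^3 \<Rightarrow> real) \<Rightarrow> real^3 \<Rightarrow> real" where
  "subtract_singular y A f F x =
     F x - (\<Sum>b\<in>{b\<in>A. b + 3 \<le> 0}. norm (x - y) powr b * f b (sgn (x - y)))"

(* I is only meaningful on the half plane Re B < 0; g is its analytic continuation to a punctured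
   neighbourhood of 0. The domain of g is connected, so c is determined by I. *)
definition has_FP :: "(complex \<Rightarrow> complex) \<Rightarrow> complex \<Rightarrow> bool" where
  "has_FP I c \<longleftrightarrow>
     (\<exists>g \<delta> L. \<delta> > 0 \<and>
        g holomorphic_on ({B. Re B < 0} \<union> (ball 0 \<delta> - {0})) \<and>
        (\<forall>B. Re B < 0 \<longrightarrow> g B = I B) \<and>
        g has_laurent_expansion L \<and>
        fls_nth L 0 = c)"

definition has_FP_integral ::
    "(real^3) set \<Rightarrow> real^3 \<Rightarrow> real \<Rightarrow> (real^3 \<Rightarrow> real) \<Rightarrow> complex \<Rightarrow> bool" where
  "has_FP_integral S y \<sigma> G c \<longleftrightarrow>
     (\<forall>B. Re B < 0 \<longrightarrow>
        set_integrable lborel S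
          (\<lambda>x. complex_of_real (norm (x - y) / \<sigma>) powr B * complex_of_real (G x))) \<and>
     has_FP (\<lambda>B. LINT x : S | lborel.
        complex_of_real (norm (x - y) / \<sigma>) powr B * complex_of_real (G x)) c"

definition has_Pf_FP ::
    "real^3 \<Rightarrow> real set \<Rightarrow> (real \<Rightarrow> real^3 \<Rightarrow> real) \<Rightarrow> real \<Rightarrow> real \<Rightarrow> (real^3 \<Rightarrow> real) \<Rightarrow> complex \<Rightarrow> bool"
  where
  "has_Pf_FP y A f s1 s2 G L \<longleftrightarrow>
     (\<exists>h. (\<forall>s>0. has_FP_integral {x. norm (x - y) > s} y s2 G (h s)) \<and>
          ((\<lambda>s. h s + complex_of_real (Pf_counterterm A f s1 s)) \<longlongrightarrow> L) (at_right 0))"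

end

theory Submission
  imports Defs
begin

text \<open>
  Near \<open>y\<^sub>i\<close> let \<open>P\<^sub>i\<close> be the singular part of the expansion of \<open>F\<close>, cut off at a small radius \<open>\<rho>\<close>.
  Then \<open>G = F - P\<^sub>1 - P\<^sub>2\<close> is integrable on the whole space, and in spherical coordinates the
  integral of \<open>P\<^sub>i\<close> over the shell \<open>s < r\<^sub>i \<le> \<rho>\<close> is the difference of the counterterms at \<open>\<rho>\<close> and
  at \<open>s\<close>; so the partie finie is \<open>\<integral>G\<close> plus the counterterms at \<open>\<rho>\<close>.

  On the other side, the part of the subtracted terms with exponent \<open>b < - 3\<close> is integrable at
  infinity, and only \<open>q = r\<^sub>2^(-3) f\<close> (with \<open>f\<close> the coefficient of exponent \<open>- 3\<close>) produces a pole at \<open>B = 0\<close>.  Far away one writes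
  \<open>(r\<^sub>1/s\<^sub>2)^B = (r\<^sub>2/s\<^sub>2)^B + O(B r\<^sub>2^(B-1))\<close>: the correction is integrable against \<open>q\<close>, analytic
  near \<open>0\<close> and vanishes at \<open>B = 0\<close>, while \<open>(r\<^sub>2/s\<^sub>2)^B q\<close> integrates over \<open>r\<^sub>2 > R\<close> exactly to
  \<open>- \<Omega> (R/s\<^sub>2)^B / B\<close>, with \<open>\<Omega>\<close> the angular integral of \<open>f\<close>.  The finite part is thus an ordinary
  integral plus \<open>\<Omega> ln (R/s\<^sub>2)\<close>, and splitting its integrand as \<open>G + P\<^sub>1 - \<dots>\<close> gives the same limit.
\<close>

(* With fps_nth sharing the dollar sign, every vector component is ambiguous. *)
no_notation fps_nth (infixl "$" 75)

subsection \<open>Spherical coordinates\<close>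

text \<open>The change of variables theorem for absolutely integrable maps into
  \<open>real^1\<close> is applied to the indicator of \<open>A\<close>. The image of
  \<open>g\<close> has negligible complement, so the integral over it is the whole measure of
  \<open>A\<close>; nonnegativity then turns the gauge integral into
  \<open>nn_integral\<close>.\<close>

lemma nn_integral_jacobian:
  fixes g :: "real^'m::{finite,wellorder} \<Rightarrow> real^'m::_"
  assumes S: "S \<in> sets borel"
    and der: "\<And>x. x \<in> S \<Longrightarrow> (g has_derivative g' x) (at x within S)"
    and inj: "inj_on g S"
    and neg: "negligible (- g ` S)"
    and A: "A \<in> lmeasurable" "A \<in> sets borel"
    and [measurable]: "g \<in> borel_measurable borel" "(\<lambda>x. det (matrix (g' x))) \<in> borel_measurable borel"
  shows "(\<integral>\<^sup>+x. ennreal \<bar>det (matrix (g' x))\<bar> * indicator S x * indicator A (g x) \<partial>lborel)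
         = emeasure lborel A"
proof -
  have [measurable]: "S \<in> sets borel" "A \<in> sets borel" using S A by auto
  let ?f = "\<lambda>x. vec (indicator A x :: real) :: real^1"
  have meas_image: "g ` S \<in> sets lebesgue"
    using negligible_imp_sets[OF neg] Compl_in_sets_lebesgue[of "g ` S"] by simp
  have 1: "(\<lambda>x. indicator A x :: real) absolutely_integrable_on g ` S"
  proof (rule set_integrable_subset)
    show "(\<lambda>x. indicator A x :: real) absolutely_integrable_on UNIV"
      using A by (simp add: set_integrable_def integrable_indicator_iff fmeasurable_def)
  qed (use meas_image in auto)
  have 2: "integral (g ` S) (\<lambda>x. indicator A x :: real) = measure lebesgue A"
  proof -
    have "integral (g ` S) (\<lambda>x. indicator A x :: real) = integral UNIV (indicator A)"
      by (rule integral_spike_set; rule negligible_subset[OF neg]) auto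
    also have "\<dots> = measure lebesgue A"
      by (rule lmeasure_integral_UNIV[symmetric, OF A(1)])
    finally show ?thesis .
  qed
  have "?f absolutely_integrable_on g ` S \<and> integral (g ` S) ?f = vec (measure lebesgue A)"
    using 1 2
    by (auto simp: absolutely_integrable_on_1_iff integral_on_1_eq o_def vec_eq_iff)
  then have "(\<lambda>x. \<bar>det (matrix (g' x))\<bar> *\<^sub>R ?f (g x)) absolutely_integrable_on S"
    "integral S (\<lambda>x. \<bar>det (matrix (g' x))\<bar> *\<^sub>R ?f (g x)) = vec (measure lebesgue A)"
    using has_absolute_integral_change_of_variables[OF _ der inj, of ?f "vec (measure lebesgue A)"] S
    by auto
  then have "(\<lambda>x. \<bar>det (matrix (g' x))\<bar> * indicator A (g x)) absolutely_integrable_on S"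
    "integral S (\<lambda>x. \<bar>det (matrix (g' x))\<bar> * indicator A (g x)) = measure lebesgue A"
    by (auto simp: absolutely_integrable_on_1_iff integral_on_1_eq o_def vec_eq_iff)
  then have "((\<lambda>x. \<bar>det (matrix (g' x))\<bar> * indicator A (g x)) has_integral measure lebesgue A) S"
    using set_lebesgue_integral_eq_integral(1) has_integral_integrable_integral by blast
  then have hi: "((\<lambda>x. \<bar>det (matrix (g' x))\<bar> * indicator A (g x) * indicator S x) has_integral measure lebesgue A) UNIV"
    by (rule has_integral_on_superset[OF has_integral_eq, rotated]) (auto simp: indicator_def)
  have "(\<integral>\<^sup>+x. ennreal \<bar>det (matrix (g' x))\<bar> * indicator S x * indicator A (g x) \<partial>lborel)
     = (\<integral>\<^sup>+x. ennreal (\<bar>det (matrix (g' x))\<bar> * indicator A (g x) * indicator S x) \<partial>lborel)"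
    by (intro nn_integral_cong) (auto simp: indicator_def)
  also have "\<dots> = ennreal (measure lebesgue A)"
    by (rule nn_integral_has_integral_lborel[OF _ _ hi]) auto
  also have "\<dots> = emeasure lebesgue A"
    by (rule emeasure_eq_measure2[symmetric, OF A(1)])
  also have "\<dots> = emeasure lborel A"
    using A(2) by (simp add: emeasure_completion)
  finally show ?thesis .
qed

text \<open>Lebesgue measure is determined by its values on boxes, where the Jacobian formula
  applies. As an equality of measures it transports integrals of Banach-valued functions, not only
  of nonnegative ones.\<close>

lemma lborel_eq_density_distr:
  fixes g :: "real^'m::{finite,wellorder} \<Rightarrow> real^'m::_"
  assumes S: "S \<in> sets borel"
    and der: "\<And>x. x \<in> S \<Longrightarrow> (g has_derivative g' x) (at x within S)"
    and inj: "inj_on g S"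
    and neg: "negligible (- g ` S)"
    and g[measurable]: "g \<in> borel_measurable borel"
    and g'[measurable]: "(\<lambda>x. det (matrix (g' x))) \<in> borel_measurable borel"
  shows "lborel = distr (density lborel (\<lambda>x. ennreal \<bar>det (matrix (g' x))\<bar> * indicator S x)) borel g"
proof (rule lborel_eqI)
  note S[measurable]
  fix l u :: "real^'m::_" assume le: "\<And>b. b \<in> Basis \<Longrightarrow> l \<bullet> b \<le> u \<bullet> b"
  show "emeasure (distr (density lborel (\<lambda>x. ennreal \<bar>det (matrix (g' x))\<bar> * indicator S x)) borel g) (box l u)
      = ennreal (\<Prod>b\<in>Basis. (u - l) \<bullet> b)"
  proof -
    have v: "g -` box l u \<in> sets borel" using measurable_sets_borel[OF g, of "box l u"] by simp
    have "emeasure (distr (density lborel (\<lambda>x. ennreal \<bar>det (matrix (g' x))\<bar> * indicator S x)) borel g) (box l u)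
      = (\<integral>\<^sup>+x. ennreal \<bar>det (matrix (g' x))\<bar> * indicator S x * indicator (box l u) (g x) \<partial>lborel)"
      using v by (simp add: emeasure_distr emeasure_density indicator_vimage)
    also have "\<dots> = emeasure lborel (box l u)"
      by (rule nn_integral_jacobian[OF S der inj neg _ _ g g']) auto
    finally show ?thesis using le by (simp add: emeasure_lborel_box_eq)
  qed
qed simp

lemma prod_3: "prod f (UNIV :: 3 set) = f 1 * f 2 * f 3"
  unfolding UNIV_3 by (simp add: ac_simps)

lemma borel_measurable_vector3:
  "(\<lambda>(r, t, p). vector [r, t, p] :: real^3) \<in> borel_measurable borel"
proof (rule borel_measurable_continuous_onI)
  have "(\<lambda>(r, t, p). vector [r, t, p] :: real^3) = (\<lambda>x. \<chi> i. if i = 1 then fst x else if i = 2 then fst (snd x) else snd (snd x))"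
    by (auto simp: fun_eq_iff vec_eq_iff forall_3)
  moreover have "continuous_on UNIV (\<lambda>x::real\<times>real\<times>real. \<chi> i::3. if i = 1 then fst x else if i = 2 then fst (snd x) else snd (snd x))"
  proof (rule continuous_on_vec_lambda)
    fix i :: 3
    show "continuous_on UNIV (\<lambda>x::real\<times>real\<times>real. if i = 1 then fst x else if i = 2 then fst (snd x) else snd (snd x))"
      by (cases "i = 1"; cases "i = 2") (auto intro!: continuous_intros)
  qed
  ultimately show "continuous_on UNIV (\<lambda>(r, t, p). vector [r, t, p] :: real^3)" by simp
qed

text \<open>Jacobians live on \<open>real^3\<close>, while Fubini needs a product type; this
  identification passes from one to the other.\<close>

lemma lborel_eq_distr_vector3:
  "(lborel :: (real^3) measure) = distr lborel borel (\<lambda>(r, t, p). vector [r, t, p])"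
proof (rule lborel_eqI)
  fix l u :: "real^3" assume le: "\<And>b. b \<in> Basis \<Longrightarrow> l \<bullet> b \<le> u \<bullet> b"
  have le': "l $ i \<le> u $ i" for i
    using le[of "axis i 1"] by (auto simp: inner_axis Basis_vec_def)
  have "(\<lambda>(r, t, p). vector [r, t, p] :: real^3) -` box l u = {l$1<..<u$1} \<times> {l$2<..<u$2} \<times> {l$3<..<u$3}"
    by (auto simp: mem_box_cart forall_3)
  then have "emeasure (distr lborel borel (\<lambda>(r, t, p). vector [r, t, p])) (box l u)
     = emeasure lborel ({l$1<..<u$1} \<times> {l$2<..<u$2} \<times> {l$3<..<u$3})"
    using borel_measurable_vector3 by (simp add: emeasure_distr)
  also have "\<dots> = ennreal ((u - l)$1 * ((u - l)$2 * (u - l)$3))"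
  proof -
    have "emeasure (lborel :: (real \<times> real) measure) ({l$2<..<u$2} \<times> {l$3<..<u$3})
        = ennreal (u$2 - l$2) * ennreal (u$3 - l$3)"
      unfolding lborel_prod[symmetric] using le' by (simp add: lborel.emeasure_pair_measure_Times)
    moreover have "{l$2<..<u$2} \<times> {l$3<..<u$3} \<in> sets (lborel :: (real \<times> real) measure)"
      by (simp add: borel_Times)
    ultimately have "emeasure (lborel \<Otimes>\<^sub>M lborel :: (real \<times> real \<times> real) measure)
        ({l$1<..<u$1} \<times> {l$2<..<u$2} \<times> {l$3<..<u$3})
        = ennreal (u$1 - l$1) * (ennreal (u$2 - l$2) * ennreal (u$3 - l$3))"
      using le' by (subst lborel.emeasure_pair_measure_Times) auto
    then show ?thesis using le' unfolding lborel_prod by (simp flip: ennreal_mult)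
  qed
  also have "(u - l)$1 * ((u - l)$2 * (u - l)$3) = (\<Prod>b\<in>Basis. (u - l) \<bullet> b)"
  proof -
    have B: "(Basis :: (real^3) set) = (\<lambda>i. axis i 1) ` UNIV" by (auto simp: Basis_vec_def)
    have "inj (\<lambda>i::3. axis i (1::real))" by (auto simp: inj_on_def axis_eq_axis)
    then show ?thesis
      unfolding B by (simp add: prod.reindex inner_axis prod_3 mult.assoc)
  qed
  finally show "emeasure (distr lborel borel (\<lambda>(r, t, p). vector [r, t, p])) (box l u) = ennreal (\<Prod>b\<in>Basis. (u - l) \<bullet> b)" .
qed simp

section \<open>The spherical coordinate map\<close>

definition spherical :: "real^3 \<Rightarrow> real^3" where
  "spherical v = vector [v$1 * sin (v$2) * cos (v$3), v$1 * sin (v$2) * sin (v$3), v$1 * cos (v$2)]"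

definition spherical' :: "real^3 \<Rightarrow> real^3 \<Rightarrow> real^3" where
  "spherical' v h = vector
    [h$1 * sin (v$2) * cos (v$3) + v$1 * cos (v$2) * h$2 * cos (v$3) - v$1 * sin (v$2) * sin (v$3) * h$3,
     h$1 * sin (v$2) * sin (v$3) + v$1 * cos (v$2) * h$2 * sin (v$3) + v$1 * sin (v$2) * cos (v$3) * h$3,
     h$1 * cos (v$2) - v$1 * sin (v$2) * h$2]"

text \<open>The range of \<open>v$3\<close> is half-open and the poles are left out to make the map
  injective; its image misses only the polar axis.\<close>

definition spherical_domain :: "(real^3) set" where
  "spherical_domain = {v. 0 < v$1 \<and> 0 < v$2 \<and> v$2 < pi \<and> 0 \<le> v$3 \<and> v$3 < 2 * pi}"

lemma has_derivative_spherical: "(spherical has_derivative spherical' v) (at v within S)"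
proof -
  have *: "((\<lambda>x. a x * sin (b x) * cos (c x)) has_derivative
        (\<lambda>h. a' h * sin (b v) * cos (c v) + a v * cos (b v) * b' h * cos (c v) - a v * sin (b v) * sin (c v) * c' h)) (at v within S)"
    "((\<lambda>x. a x * sin (b x) * sin (c x)) has_derivative
        (\<lambda>h. a' h * sin (b v) * sin (c v) + a v * cos (b v) * b' h * sin (c v) + a v * sin (b v) * cos (c v) * c' h)) (at v within S)"
    "((\<lambda>x. a x * cos (b x)) has_derivative (\<lambda>h. a' h * cos (b v) - a v * sin (b v) * b' h)) (at v within S)"
    if "(a has_derivative a') (at v within S)" "(b has_derivative b') (at v within S)" "(c has_derivative c') (at v within S)"
    for a b c a' b' c' :: "real^3 \<Rightarrow> real"
    by (rule derivative_eq_intros that refl | simp add: fun_eq_iff algebra_simps)+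
  have nth: "((\<lambda>x::real^3. x $ i) has_derivative (\<lambda>h. h $ i)) (at v within S)" for i
    by (rule bounded_linear.has_derivative[OF bounded_linear_vec_nth has_derivative_ident])
  have "((\<lambda>x. spherical x $ 1) has_derivative (\<lambda>h. spherical' v h $ 1)) (at v within S)"
    unfolding spherical_def spherical'_def vector_3 by (rule *(1)[OF nth nth nth])
  moreover have "((\<lambda>x. spherical x $ 2) has_derivative (\<lambda>h. spherical' v h $ 2)) (at v within S)"
    unfolding spherical_def spherical'_def vector_3 by (rule *(2)[OF nth nth nth])
  moreover have "((\<lambda>x. spherical x $ 3) has_derivative (\<lambda>h. spherical' v h $ 3)) (at v within S)"
    unfolding spherical_def spherical'_def vector_3 by (rule *(3)[OF nth nth nth])
  ultimately have "\<forall>i. ((\<lambda>x. spherical x $ i) has_derivative (\<lambda>h. spherical' v h $ i)) (at v within S)"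
    by (simp only: forall_3 simp_thms)
  then show ?thesis
    by (subst has_derivative_componentwise_within) (auto simp: Basis_vec_def inner_axis)
qed

lemma det_spherical': "det (matrix (spherical' v)) = (v$1)\<^sup>2 * sin (v$2)"
proof -
  have "det (matrix (spherical' v)) = (v$1)\<^sup>2 * sin (v$2) *
     (((sin (v$2))\<^sup>2 + (cos (v$2))\<^sup>2) * ((sin (v$3))\<^sup>2 + (cos (v$3))\<^sup>2))"
    unfolding det_3 matrix_def spherical'_def using sin_cos_squared_add[of "v$2"] sin_cos_squared_add[of "v$3"]
    by (simp add: axis_def del: sin_cos_squared_add) algebra
  then show ?thesis by simp
qed

lemma norm_spherical: "norm (spherical v) = \<bar>v$1\<bar>"
proof -
  have "(norm (spherical v))\<^sup>2 = (v$1)\<^sup>2 *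
    ((sin (v$2))\<^sup>2 * ((sin (v$3))\<^sup>2 + (cos (v$3))\<^sup>2) + (cos (v$2))\<^sup>2)"
    unfolding power2_norm_eq_inner inner_vec_def sum_3 spherical_def
    using sin_cos_squared_add[of "v$2"] sin_cos_squared_add[of "v$3"]
    by (simp del: sin_cos_squared_add) algebra
  then have "(norm (spherical v))\<^sup>2 = \<bar>v$1\<bar>\<^sup>2" by simp
  then show ?thesis by (rule power2_eq_imp_eq) auto
qed

lemma inj_on_spherical: "inj_on spherical spherical_domain"
proof (rule inj_onI)
  fix v w assume v: "v \<in> spherical_domain" and w: "w \<in> spherical_domain" and eq: "spherical v = spherical w"
  have r: "v$1 = w$1"
    using arg_cong[OF eq, of norm] v w by (auto simp: norm_spherical spherical_domain_def)
  have "cos (v$2) = cos (w$2)"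
    using arg_cong[OF eq, of "\<lambda>x. x$3"] v w r by (auto simp: spherical_def spherical_domain_def)
  then have t: "v$2 = w$2"
    by (rule cos_inj_pi[rotated 4]) (use v w in \<open>auto simp: spherical_domain_def\<close>)
  have "sin (v$2) > 0" using v by (intro sin_gt_zero) (auto simp: spherical_domain_def)
  then have "cos (v$3) = cos (w$3)" "sin (v$3) = sin (w$3)"
    using arg_cong[OF eq, of "\<lambda>x. x$1"] arg_cong[OF eq, of "\<lambda>x. x$2"] v w r t
    by (auto simp: spherical_def spherical_domain_def)
  then obtain n :: int where n: "v$3 = w$3 + 2 * pi * n"
    using sin_cos_eq_iff by (metis mult.commute mult.left_commute)
  have "\<bar>2 * pi * n\<bar> < 2 * pi * 1" using n v w by (auto simp: spherical_domain_def)
  then have "\<bar>real_of_int n\<bar> < 1" by (auto simp: abs_mult)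
  then have "n = 0" by linarith
  then show "v = w" using n r t by (simp add: vec_eq_iff forall_3)
qed

text \<open>The missed axis lies in the hyperplane \<open>x$1 = 0\<close>. A point off the
  hyperplane has positive distance \<open>s\<close> from the axis, and its two angles are read off
  from points of unit circles.\<close>

lemma negligible_compl_spherical_image: "negligible (- spherical ` spherical_domain)"
proof (rule negligible_subset)
  show "negligible {x::real^3. x $ 1 = 0}"
    by (rule negligible_standard_hyperplane_cart)
  show "- spherical ` spherical_domain \<subseteq> {x. x $ 1 = 0}"
  proof (rule ccontr)
    assume "\<not> - spherical ` spherical_domain \<subseteq> {x. x $ 1 = 0}"
    then obtain x where x: "x \<notin> spherical ` spherical_domain" "x$1 \<noteq> 0" by auto
    define r where "r = norm x"
    define s where "s = sqrt ((x$1)\<^sup>2 + (x$2)\<^sup>2)"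
    have r2: "r\<^sup>2 = (x$1)\<^sup>2 + (x$2)\<^sup>2 + (x$3)\<^sup>2"
      unfolding r_def power2_norm_eq_inner inner_vec_def sum_3 by (simp add: power2_eq_square)
    have s2: "s\<^sup>2 = (x$1)\<^sup>2 + (x$2)\<^sup>2" unfolding s_def by simp
    have s: "s > 0" unfolding s_def using x(2) by (simp add: add_pos_nonneg)
    have r: "r > 0" unfolding r_def using x(2) by auto
    have "(x$3)\<^sup>2 + s\<^sup>2 = r\<^sup>2" unfolding r2 s2 by simp
    then have "(x$3 / r)\<^sup>2 + (s / r)\<^sup>2 = 1"
      using r by (simp add: power_divide flip: add_divide_distrib)
    then obtain t where t: "0 \<le> t" "t \<le> pi" "x$3 / r = cos t" "s / r = sin t"
      using sincos_total_pi[of "s / r" "x$3 / r"] r s by auto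
    have "(x$1 / s)\<^sup>2 + (x$2 / s)\<^sup>2 = 1"
      using s s2 x(2) by (simp add: power_divide flip: add_divide_distrib)
    then obtain p where p: "0 \<le> p" "p < 2 * pi" "x$1 / s = cos p" "x$2 / s = sin p"
      using sincos_total_2pi by metis
    have "sin t > 0" using t(4) s r by (metis divide_pos_pos)
    then have "t \<noteq> 0" "t \<noteq> pi" by auto
    then have "vector [r, t, p] \<in> spherical_domain"
      using r t p by (auto simp: spherical_domain_def)
    moreover have "spherical (vector [r, t, p]) = x"
      using t(3,4) p(3,4) r s by (auto simp: spherical_def vec_eq_iff forall_3 simp flip: t(3,4) p(3,4))
    ultimately show False using x(1) by (metis imageI)
  qed
qed

definition unit_vec :: "real \<times> real \<Rightarrow> real^3" where
  "unit_vec p = vector [sin (fst p) * cos (snd p), sin (fst p) * sin (snd p), cos (fst p)]"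

text \<open>The Jacobian, supported on the closed rectangle of angles that
  \<open>solid_angle_integral\<close> uses instead of on \<open>spherical_domain\<close>.\<close>

definition polar_density :: "real \<times> real \<times> real \<Rightarrow> real" where
  "polar_density z = (fst z)\<^sup>2 * sin (fst (snd z)) *
     indicator ({0<..} \<times> ({0..pi} \<times> {0..2*pi})) z"

lemma spherical_vector: "spherical (vector [r, t, p]) = r *\<^sub>R unit_vec (t, p)"
  by (simp add: spherical_def unit_vec_def vec_eq_iff forall_3)

lemma norm_unit_vec [simp]: "norm (unit_vec p) = 1"
proof -
  have "norm (spherical (vector [1, fst p, snd p])) = 1"
    unfolding norm_spherical by simp
  then show ?thesis by (simp add: spherical_vector)
qed

lemma sgn_unit_vec [simp]: "sgn (unit_vec p) = unit_vec p"
  by (simp add: sgn_div_norm)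

lemma continuous_on_unit_vec: "continuous_on S unit_vec"
proof -
  have eq: "unit_vec = (\<lambda>p. \<chi> i. if i = 1 then sin (fst p) * cos (snd p)
      else if i = 2 then sin (fst p) * sin (snd p) else cos (fst p))"
    by (auto simp: unit_vec_def fun_eq_iff vec_eq_iff forall_3)
  show "continuous_on S unit_vec" unfolding eq
  proof (rule continuous_on_vec_lambda)
    fix i :: 3
    show "continuous_on S (\<lambda>p::real\<times>real. if i = 1 then sin (fst p) * cos (snd p)
      else if i = 2 then sin (fst p) * sin (snd p) else cos (fst p))"
      by (cases "i = 1"; cases "i = 2") (auto intro!: continuous_intros)
  qed
qed

lemma borel_measurable_unit_vec [measurable]: "unit_vec \<in> borel_measurable borel"
  by (intro borel_measurable_continuous_onI continuous_on_unit_vec)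

lemma borel_measurable_polar_density [measurable]: "polar_density \<in> borel_measurable borel"
proof -
  have [measurable]: "{0<..} \<times> ({0..pi} \<times> {0..2*pi}) \<in> sets (borel :: (real \<times> real \<times> real) measure)"
    by (intro borel_Times) auto
  have [measurable]: "(\<lambda>z::real \<times> real \<times> real. (fst z)\<^sup>2 * sin (fst (snd z))) \<in> borel_measurable borel"
    by (intro borel_measurable_continuous_onI continuous_intros)
  show ?thesis unfolding polar_density_def[abs_def] by measurable
qed

lemma polar_density_nonneg: "polar_density z \<ge> 0"
  by (auto simp: polar_density_def indicator_def sin_ge_zero)

lemma borel_measurable_spherical: "spherical \<in> borel_measurable borel"
proof -
  have "continuous_on UNIV spherical"
    by (intro differentiable_imp_continuous_on) 
      (auto simp: differentiable_on_def differentiable_def intro!: has_derivative_spherical)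
  then show ?thesis by (rule borel_measurable_continuous_onI)
qed

lemma spherical_domain_borel: "spherical_domain \<in> sets borel"
proof -
  have [measurable]: "(\<lambda>v::real^3. v $ i) \<in> borel_measurable borel" for i
    by (intro borel_measurable_continuous_onI continuous_intros)
  have "{v \<in> space borel. 0 < v$1 \<and> 0 < v$2 \<and> v$2 < pi \<and> 0 \<le> v$3 \<and> v$3 < 2 * pi} \<in> sets (borel :: (real^3) measure)"
    by measurable
  then show ?thesis by (simp add: spherical_domain_def)
qed

lemma lborel_eq_polar:
  "(lborel :: (real^3) measure) =
     distr (density lborel (\<lambda>z. ennreal (polar_density z))) borel (\<lambda>z. fst z *\<^sub>R unit_vec (snd z))"
proof -
  note [measurable] = borel_measurable_spherical spherical_domain_borel
  have [measurable]: "(\<lambda>v::real^3. v $ i) \<in> borel_measurable borel" for i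
    by (intro borel_measurable_continuous_onI continuous_intros)
  let ?V = "(\<lambda>(r, t, p). vector [r, t, p]) :: real \<times> real \<times> real \<Rightarrow> real^3"
  let ?d = "\<lambda>v. ennreal \<bar>det (matrix (spherical' v))\<bar> * indicator spherical_domain v"
  have V [measurable]: "?V \<in> borel_measurable borel" by (rule borel_measurable_vector3)
  have [measurable]: "?d \<in> borel_measurable borel" unfolding det_spherical' by measurable
  have "(lborel :: (real^3) measure) = distr (density lborel ?d) borel spherical"
    by (rule lborel_eq_density_distr[OF spherical_domain_borel has_derivative_spherical inj_on_spherical
          negligible_compl_spherical_image]) (simp_all add: det_spherical')
  also have "density lborel ?d = density (distr lborel borel ?V) ?d"
    by (subst lborel_eq_distr_vector3) simp
  also have "\<dots> = distr (density lborel (\<lambda>z. ?d (?V z))) borel ?V"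
    by (rule density_distr) auto
  also have "density lborel (\<lambda>z. ?d (?V z)) = density lborel (\<lambda>z. ennreal (polar_density z))"
  proof (rule density_cong)
    \<comment> \<open>The two densities can differ only where the azimuth is \<open>2 * pi\<close>,
      a null set: at the poles the factor \<open>sin\<close> vanishes.\<close>
    have "AE z in lborel. z \<bullet> (0, 0, 1::real) \<noteq> 2 * pi"
      by (rule AE_lborel_inner_neq) (auto simp: Basis_prod_def)
    then show "AE z in lborel. ?d (?V z) = ennreal (polar_density z)"
    proof eventually_elim
      case (elim z)
      obtain r t p where z: "z = (r, t, p)" by (cases z)
      show ?case using elim unfolding z
        by (cases "t = 0"; cases "t = pi")
          (auto simp: polar_density_def det_spherical' spherical_domain_def indicator_def abs_mult sin_ge_zero)
    qed
  qed (auto simp: measurable_compose[OF V])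
  also have "distr (distr (density lborel (\<lambda>z. ennreal (polar_density z))) borel ?V) borel spherical
     = distr (density lborel (\<lambda>z. ennreal (polar_density z))) borel (spherical \<circ> ?V)"
    by (rule distr_distr) auto
  also have "spherical \<circ> ?V = (\<lambda>z. fst z *\<^sub>R unit_vec (snd z))"
    by (auto simp: spherical_vector)
  finally show ?thesis .
qed

section \<open>Integrals of products of a radial and an angular function\<close>

lemma solid_angle_integral_unit_vec:
  "solid_angle_integral f =
     (LINT p|lborel. indicator ({0..pi} \<times> {0..2*pi}) p * (f (unit_vec p) * sin (fst p)))"
  by (simp add: solid_angle_integral_def unit_vec_def set_lebesgue_integral_def)

text \<open>At \<open>x = y\<close> the direction is \<open>sgn 0 = 0\<close>, off the sphere, where
  nothing is known about \<open>f\<close>; one exceptional point does not affect Borel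
  measurability.\<close>

lemma borel_measurable_sgn_comp:
  assumes "continuous_on (sphere 0 1) (f :: real^3 \<Rightarrow> real)"
  shows "(\<lambda>x. f (sgn (x - y))) \<in> borel_measurable borel"
proof (rule borel_measurable_continuous_countable_exceptions)
  show "continuous_on (- {y}) (\<lambda>x. f (sgn (x - y)))"
    by (rule continuous_on_compose2[OF assms])
       (auto intro!: continuous_on_sgn continuous_intros simp: norm_sgn split: if_splits)
qed simp

text \<open>In polar coordinates the integrand times the density is a product
  \<open>w p *\<^sub>R k r\<close>, so Fubini factorizes the integral. Banach-valued
  \<open>h\<close> covers both the real powers and the complex weights.\<close>

lemma integral_radial_angular_origin:
  fixes h :: "real \<Rightarrow> 'b::{banach, second_countable_topology}" and f :: "real^3 \<Rightarrow> real"
  assumes f: "continuous_on (sphere 0 1) f" and h [measurable]: "h \<in> borel_measurable borel"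
    and int: "set_integrable lborel {0<..} (\<lambda>r. r\<^sup>2 *\<^sub>R h r)"
  shows "integrable lborel (\<lambda>x. f (sgn x) *\<^sub>R h (norm x))"
    and "(LINT x|lborel. f (sgn x) *\<^sub>R h (norm x))
      = solid_angle_integral f *\<^sub>R (LINT r:{0<..}|lborel. r\<^sup>2 *\<^sub>R h r)"
proof -
  define k where "k r = indicator {0<..} r *\<^sub>R (r\<^sup>2 *\<^sub>R h r)" for r
  define w where "w p = indicator ({0..pi} \<times> {0..2*pi}) p * (f (unit_vec p) * sin (fst p))" for p
  define u where "u x = f (sgn x) *\<^sub>R h (norm x)" for x :: "real^3"
  have fs [measurable]: "(\<lambda>x. f (sgn x)) \<in> borel_measurable borel"
    using borel_measurable_sgn_comp[OF f, of 0] by simp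
  have u [measurable]: "u \<in> borel_measurable borel" unfolding u_def[abs_def] by measurable
  have k: "integrable lborel k" using int unfolding set_integrable_def k_def[abs_def] by simp
  have w: "integrable lborel w"
    unfolding w_def[abs_def] real_scaleR_def[symmetric]
    by (intro borel_integrable_compact compact_Times compact_Icc continuous_intros
        continuous_on_compose2[OF f] continuous_on_unit_vec) auto
  have wk: "integrable (lborel \<Otimes>\<^sub>M lborel) (\<lambda>(r, p). w p *\<^sub>R k r)"
  proof (rule lborel_pair.Fubini_integrable)
    show "(\<lambda>(r, p). w p *\<^sub>R k r) \<in> borel_measurable (lborel \<Otimes>\<^sub>M lborel)"
      using borel_measurable_integrable[OF k] borel_measurable_integrable[OF w] by measurable
    show "integrable lborel (\<lambda>x. LINT y|lborel. norm (case (x, y) of (r, p) \<Rightarrow> w p *\<^sub>R k r))"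
      using k by simp
    show "AE x in lborel. integrable lborel (\<lambda>y. case (x, y) of (r, p) \<Rightarrow> w p *\<^sub>R k r)"
      using w by simp
  qed
  have *: "polar_density z *\<^sub>R u (fst z *\<^sub>R unit_vec (snd z)) = (case z of (r, p) \<Rightarrow> w p *\<^sub>R k r)" for z
    by (cases z) (auto simp: polar_density_def u_def w_def k_def indicator_def sgn_scaleR mult_ac)
  have m [measurable]: "(\<lambda>z::real \<times> real \<times> real. fst z *\<^sub>R unit_vec (snd z)) \<in> borel_measurable borel"
    by (intro borel_measurable_continuous_onI continuous_intros
        continuous_on_compose2[OF continuous_on_unit_vec[of UNIV]]) auto
  have "integrable (density lborel (\<lambda>z. ennreal (polar_density z))) (\<lambda>z. u (fst z *\<^sub>R unit_vec (snd z)))"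
    using wk unfolding lborel_prod
    by (subst integrable_density) (auto simp: polar_density_nonneg * )
  then have "integrable lborel u"
    by (subst lborel_eq_polar, subst integrable_distr_eq) auto
  then show "integrable lborel (\<lambda>x. f (sgn x) *\<^sub>R h (norm x))" by (simp add: u_def[abs_def])
  have "(LINT x|lborel. u x) = (LINT z|lborel. polar_density z *\<^sub>R u (fst z *\<^sub>R unit_vec (snd z)))"
    by (subst lborel_eq_polar, subst integral_distr) (auto simp: integral_density polar_density_nonneg)
  also have "\<dots> = (LINT z|(lborel \<Otimes>\<^sub>M lborel). (case z of (r, p) \<Rightarrow> w p *\<^sub>R k r))"
    unfolding * lborel_prod ..
  also have "\<dots> = (LINT r|lborel. LINT p|lborel. w p *\<^sub>R k r)"
    using lborel_pair.integral_fst'[OF wk] by simp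
  also have "\<dots> = (LINT r|lborel. (LINT p|lborel. w p) *\<^sub>R k r)"
    using w by simp
  also have "\<dots> = (LINT p|lborel. w p) *\<^sub>R (LINT r|lborel. k r)"
    by simp
  finally show "(LINT x|lborel. f (sgn x) *\<^sub>R h (norm x))
      = solid_angle_integral f *\<^sub>R (LINT r:{0<..}|lborel. r\<^sup>2 *\<^sub>R h r)"
    by (simp add: u_def k_def w_def[abs_def] solid_angle_integral_unit_vec set_lebesgue_integral_def)
qed

lemma integral_radial_angular:
  fixes h :: "real \<Rightarrow> 'b::{banach, second_countable_topology}" and f :: "real^3 \<Rightarrow> real"
  assumes f: "continuous_on (sphere 0 1) f" and h [measurable]: "h \<in> borel_measurable borel"
    and int: "set_integrable lborel {0<..} (\<lambda>r. r\<^sup>2 *\<^sub>R h r)"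
  shows "integrable lborel (\<lambda>x. f (sgn (x - y)) *\<^sub>R h (norm (x - y)))"
    and "(LINT x|lborel. f (sgn (x - y)) *\<^sub>R h (norm (x - y)))
      = solid_angle_integral f *\<^sub>R (LINT r:{0<..}|lborel. r\<^sup>2 *\<^sub>R h r)"
proof -
  define u where "u x = f (sgn x) *\<^sub>R h (norm x)" for x :: "real^3"
  have [measurable]: "(\<lambda>x. f (sgn x)) \<in> borel_measurable borel"
    using borel_measurable_sgn_comp[OF f, of 0] by simp
  have u [measurable]: "u \<in> borel_measurable borel" unfolding u_def[abs_def] by measurable
  note 0 = integral_radial_angular_origin[OF f h int, folded u_def]
  have "integrable lborel (\<lambda>x. u (- y + x))"
    using 0(1) by (subst (asm) lborel_distr_plus[of "- y", symmetric], subst (asm) integrable_distr_eq) auto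
  then show "integrable lborel (\<lambda>x. f (sgn (x - y)) *\<^sub>R h (norm (x - y)))"
    by (simp add: u_def)
  have "(LINT x|lborel. u x) = (LINT x|lborel. u (- y + x))"
    by (subst lborel_distr_plus[of "- y", symmetric], subst integral_distr) auto
  then show "(LINT x|lborel. f (sgn (x - y)) *\<^sub>R h (norm (x - y)))
      = solid_angle_integral f *\<^sub>R (LINT r:{0<..}|lborel. r\<^sup>2 *\<^sub>R h r)"
    using 0(2) by (simp add: u_def)
qed

subsection \<open>Homogeneous functions on shells\<close>

text \<open>For a nonnegative function the gauge integral fixes \<open>nn_integral\<close>, whose
  finiteness gives Lebesgue integrability. Power integrals can thus be taken from
  antiderivatives.\<close>

lemma set_integrable_lborel_nonneg:
  fixes f :: "real \<Rightarrow> real"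
  assumes f [measurable]: "f \<in> borel_measurable borel" and S [measurable]: "S \<in> sets borel"
    and nn: "\<And>x. x \<in> S \<Longrightarrow> 0 \<le> f x" and I: "(f has_integral I) S"
  shows "set_integrable lborel S f" and "(LINT x:S|lborel. f x) = I"
proof -
  have hi: "((\<lambda>x. indicator S x * f x) has_integral I) UNIV"
  proof -
    have "(\<lambda>x. indicator S x * f x) = (\<lambda>x. if x \<in> S then f x else 0)" by (auto simp: indicator_def)
    then show ?thesis using I by (simp only: has_integral_restrict_UNIV)
  qed
  have "integral\<^sup>N lborel (\<lambda>x. indicator S x * f x) = I"
    by (rule nn_integral_has_integral_lborel[OF _ _ hi]) (use nn in \<open>auto simp: indicator_def\<close>)
  then show int: "set_integrable lborel S f"
    unfolding set_integrable_def real_scaleR_def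
    by (intro integrableI_nonneg) (use nn in \<open>auto simp: indicator_def\<close>)
  show "(LINT x:S|lborel. f x) = I"
    using set_borel_integral_eq_integral(2)[OF int] I by (simp add: integral_unique)
qed

lemma has_integral_Ioi_powr:
  fixes R e :: real
  assumes "R > 0" "e < -1"
  shows "((\<lambda>r. r powr e) has_integral - (R powr (e + 1)) / (e + 1)) {R<..}"
  by (subst has_integral_spike_set_eq[of _ "{R..}"])
     (use has_integral_powr_to_inf[OF assms(2,1)] in \<open>auto intro: negligible_subset[of "{R}"]\<close>)

lemma has_integral_Ioc_powr:
  fixes s \<rho> e :: real
  assumes "0 < s" "s \<le> \<rho>"
  shows "((\<lambda>r. r powr e) has_integral
    (if e = -1 then ln (\<rho> / s) else (\<rho> powr (e + 1) - s powr (e + 1)) / (e + 1))) {s<..\<rho>}"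
proof (subst has_integral_spike_set_eq[of _ "{s..\<rho>}"])
  show "((\<lambda>r. r powr e) has_integral
    (if e = -1 then ln (\<rho> / s) else (\<rho> powr (e + 1) - s powr (e + 1)) / (e + 1))) {s..\<rho>}"
  proof (cases "e = -1")
    case True
    have "((\<lambda>r. r powr e) has_integral (ln \<rho> - ln s)) {s..\<rho>}"
      using assms True
      by (intro fundamental_theorem_of_calculus)
         (auto intro!: derivative_eq_intros simp: powr_minus divide_inverse
           simp flip: has_real_derivative_iff_has_vector_derivative)
    then show ?thesis using True assms by (simp add: ln_div)
  next
    case False
    then have [simp]: "e + 1 \<noteq> 0" by linarith
    have "((\<lambda>r. r powr e) has_integral (\<rho> powr (e+1) / (e+1) - s powr (e+1) / (e+1))) {s..\<rho>}"
      using assms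
      by (intro fundamental_theorem_of_calculus)
         (auto intro!: derivative_eq_intros
           simp flip: has_real_derivative_iff_has_vector_derivative)
    then show ?thesis using False by (simp add: diff_divide_distrib)
  qed
qed (auto intro: negligible_subset[of "{s}"])

text \<open>The exponent \<open>a + 2\<close> includes the factor \<open>r^2\<close> of the volume
  element. \<open>S\<close> is left general to serve shells, exteriors of balls and punctured balls
  alike.\<close>

lemma
  fixes f :: "real^3 \<Rightarrow> real" and y :: "real^3"
  assumes f: "continuous_on (sphere 0 1) f" and S [measurable]: "S \<in> sets borel" and S0: "S \<subseteq> {0<..}"
    and I: "((\<lambda>r. r powr (a + 2)) has_integral I) S"
  shows integrable_powr_angular:
      "integrable lborel (\<lambda>x. indicator S (norm (x - y)) * (norm (x - y) powr a * f (sgn (x - y))))"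
    and integral_powr_angular:
      "(LINT x|lborel. indicator S (norm (x - y)) * (norm (x - y) powr a * f (sgn (x - y))))
        = solid_angle_integral f * I"
proof -
  let ?h = "\<lambda>r::real. indicator S r * r powr a"
  have eq: "indicator {0<..} r *\<^sub>R (r\<^sup>2 *\<^sub>R ?h r) = indicator S r *\<^sub>R r powr (a + 2)" for r
    using S0 by (auto simp: indicator_def powr_add)
  note 1 = set_integrable_lborel_nonneg[OF _ S _ I]
  have "set_integrable lborel {0<..} (\<lambda>r. r\<^sup>2 *\<^sub>R ?h r)"
    using 1(1) unfolding set_integrable_def eq by simp
  note 2 = integral_radial_angular[OF f _ this, of y]
  have 3: "f (sgn (x - y)) *\<^sub>R ?h (norm (x - y)) =
      indicator S (norm (x - y)) * (norm (x - y) powr a * f (sgn (x - y)))" for x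
    by simp
  show "integrable lborel (\<lambda>x. indicator S (norm (x - y)) * (norm (x - y) powr a * f (sgn (x - y))))"
    using 2(1) unfolding 3 by simp
  show "(LINT x|lborel. indicator S (norm (x - y)) * (norm (x - y) powr a * f (sgn (x - y))))
        = solid_angle_integral f * I"
    using 2(2) 1(2) unfolding 3 set_lebesgue_integral_def eq by simp
qed

text \<open>This is the source of the pole at \<open>B = 0\<close>:
  \<open>exp (B ln (r / \<sigma>)) / B\<close> is an antiderivative, it vanishes at infinity because
  \<open>Re B < 0\<close>, and the lower endpoint leaves a quotient by \<open>B\<close>.\<close>

lemma
  assumes R: "R > 0" and \<sigma>: "\<sigma> > 0" and B: "Re B < 0"
  shows set_integrable_Ioi_exp_ln:
      "set_integrable lborel {R<..} (\<lambda>r. exp (B * of_real (ln (r / \<sigma>))) / of_real r)"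
    and integral_Ioi_exp_ln:
      "(LINT r:{R<..}|lborel. exp (B * of_real (ln (r / \<sigma>))) / of_real r)
        = - exp (B * of_real (ln (R / \<sigma>))) / B"
proof -
  let ?g = "\<lambda>r. exp (B * complex_of_real (ln (r / \<sigma>))) / complex_of_real r"
  have g [measurable]: "?g \<in> borel_measurable borel" by measurable
  show int: "set_integrable lborel {R<..} ?g"
    unfolding set_integrable_def
  proof (rule Bochner_Integration.integrable_bound)
    have "set_integrable lborel {R<..} (\<lambda>r. r powr (Re B - 1))"
      by (rule set_integrable_lborel_nonneg(1)[OF _ _ _ has_integral_Ioi_powr]) (use R B in auto)
    then show "integrable lborel (\<lambda>r. \<sigma> powr (- Re B) * (indicator {R<..} r *\<^sub>R r powr (Re B - 1)))"
      unfolding set_integrable_def by simp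
    show "AE r in lborel. norm (indicator {R<..} r *\<^sub>R ?g r)
        \<le> norm (\<sigma> powr (- Re B) * (indicator {R<..} r *\<^sub>R r powr (Re B - 1)))"
    proof (rule AE_I2)
      fix r
      have "norm (?g r) = \<sigma> powr (- Re B) * r powr (Re B - 1)" if "r > R"
      proof -
        have "norm (?g r) = (r / \<sigma>) powr Re B / r"
          using that R \<sigma> by (simp add: norm_divide powr_def)
        then show ?thesis
          using that R \<sigma> by (simp add: powr_divide powr_minus powr_diff field_simps)
      qed
      then show "norm (indicator {R<..} r *\<^sub>R ?g r)
        \<le> norm (\<sigma> powr (- Re B) * (indicator {R<..} r *\<^sub>R r powr (Re B - 1)))"
        by (simp add: indicator_def)
    qed
  qed measurable
  let ?G = "\<lambda>r. exp (B * complex_of_real (ln (r / \<sigma>))) / B"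
  have B0: "B \<noteq> 0" using B by auto
  \<comment> \<open>Up to a finite \<open>u\<close> the fundamental theorem applies;
    \<open>tendsto_integral_at_top\<close> then lets \<open>u\<close> go to infinity.\<close>
  have fin: "(LINT x|lborel. indicator {..u} x *\<^sub>R (indicator {R<..} x *\<^sub>R ?g x)) = ?G u - ?G R" if u: "u \<ge> R" for u
  proof -
    have "(LINT x|lborel. indicator {..u} x *\<^sub>R (indicator {R<..} x *\<^sub>R ?g x))
        = (LINT x|lborel. indicator {R..u} x *\<^sub>R ?g x)"
    proof (rule integral_cong_AE)
      show "AE x in lborel. indicator {..u} x *\<^sub>R (indicator {R<..} x *\<^sub>R ?g x) = indicator {R..u} x *\<^sub>R ?g x"
        using AE_lborel_singleton[of R] by eventually_elim (auto simp: indicator_def)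
    qed measurable
    also have "\<dots> = ?G u - ?G R"
    proof (rule integral_FTC_atLeastAtMost[OF u])
      fix x assume x: "R \<le> x" "x \<le> u"
      then have x0: "x > 0" using R by linarith
      have "((\<lambda>r. ln (r / \<sigma>)) has_real_derivative 1 / x) (at x within {R..u})"
        using x0 \<sigma> by (auto intro!: derivative_eq_intros)
      then have "((\<lambda>r. complex_of_real (ln (r / \<sigma>))) has_vector_derivative complex_of_real (1 / x)) (at x within {R..u})"
        by (intro has_vector_derivative_of_real) (simp add: has_real_derivative_iff_has_vector_derivative)
      then have "((\<lambda>z. exp (B * z) / B) \<circ> (\<lambda>r. complex_of_real (ln (r / \<sigma>))) has_vector_derivative
          complex_of_real (1 / x) * (exp (B * complex_of_real (ln (x / \<sigma>))))) (at x within {R..u})"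
        by (rule field_vector_diff_chain_within) (use B0 in \<open>auto intro!: derivative_eq_intros\<close>)
      then show "(?G has_vector_derivative ?g x) (at x within {R..u})"
        by (simp add: o_def)
    next
      show "continuous_on {R..u} ?g"
        using R \<sigma> by (intro continuous_intros) auto
    qed
    finally show ?thesis .
  qed
  have "((\<lambda>u. LINT x|lborel. indicator {..u} x *\<^sub>R (indicator {R<..} x *\<^sub>R ?g x))
      \<longlongrightarrow> (LINT x|lborel. indicator {R<..} x *\<^sub>R ?g x)) at_top"
    by (rule tendsto_integral_at_top) (use int in \<open>simp_all add: set_integrable_def\<close>)
  moreover have "((\<lambda>u. LINT x|lborel. indicator {..u} x *\<^sub>R (indicator {R<..} x *\<^sub>R ?g x))
      \<longlongrightarrow> 0 - ?G R) at_top"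
  proof (rule Lim_transform_eventually)
    have "((\<lambda>u. norm (?G u)) \<longlongrightarrow> 0) at_top"
    proof -
      have "LIM u at_top. inverse \<sigma> * u :> at_top"
        by (rule filterlim_tendsto_pos_mult_at_top[OF tendsto_const _ filterlim_ident]) (use \<sigma> in simp)
      then have "LIM u at_top. u / \<sigma> :> at_top"
        by (simp add: divide_inverse mult.commute)
      then have "((\<lambda>u. (u / \<sigma>) powr Re B / norm B) \<longlongrightarrow> 0) at_top"
        by (intro tendsto_divide_zero tendsto_neg_powr B)
      then show ?thesis
        by (rule Lim_transform_eventually)
           (use eventually_gt_at_top[of 0] in eventually_elim, use \<sigma> in \<open>simp add: norm_divide powr_def\<close>)
    qed
    then have "(?G \<longlongrightarrow> 0) at_top" by (rule tendsto_norm_zero_cancel)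
    then show "((\<lambda>u. ?G u - ?G R) \<longlongrightarrow> 0 - ?G R) at_top" by (intro tendsto_intros)
    show "\<forall>\<^sub>F u in at_top. ?G u - ?G R = (LINT x|lborel. indicator {..u} x *\<^sub>R (indicator {R<..} x *\<^sub>R ?g x))"
      using eventually_ge_at_top[of R] by eventually_elim (rule fin[symmetric])
  qed
  ultimately show "(LINT r:{R<..}|lborel. ?g r) = - exp (B * of_real (ln (R / \<sigma>))) / B"
    unfolding set_lebesgue_integral_def using tendsto_unique by (metis (no_types, lifting) trivial_limit_at_top_linorder diff_0 minus_divide_left)
qed

lemma complex_powr_of_real:
  "x > 0 \<Longrightarrow> complex_of_real x powr B = exp (B * of_real (ln x))"
  by (simp add: powr_def Ln_of_real)

text \<open>The cube in \<open>r powr -3\<close> and the \<open>r^2\<close> of the volume element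
  leave \<open>1 / r\<close>, so the radial integral is the one just computed. The weight is written
  with complex \<open>powr\<close>, as in \<open>has_FP_integral\<close>, and becomes
  \<open>exp\<close> at positive radii.\<close>

lemma
  fixes f :: "real^3 \<Rightarrow> real" and y :: "real^3"
  assumes f: "continuous_on (sphere 0 1) f" and R: "R > 0" and \<sigma>: "\<sigma> > 0" and B: "Re B < 0"
  defines "u \<equiv> \<lambda>x. indicator {R<..} (norm (x - y)) *\<^sub>R
      (complex_of_real (norm (x - y) / \<sigma>) powr B * complex_of_real (norm (x - y) powr -3 * f (sgn (x - y))))"
  shows integrable_complex_powr_angular: "integrable lborel u"
    and integral_complex_powr_angular:
      "(LINT x|lborel. u x) = - of_real (solid_angle_integral f) * exp (B * of_real (ln (R / \<sigma>))) / B"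
proof -
  define h where "h r = indicator {R<..} r *\<^sub>R (exp (B * complex_of_real (ln (r / \<sigma>))) * complex_of_real (r powr -3))" for r
  have h [measurable]: "h \<in> borel_measurable borel" unfolding h_def[abs_def] by measurable
  have eq: "indicator {0<..} r *\<^sub>R (r\<^sup>2 *\<^sub>R h r) = indicator {R<..} r *\<^sub>R (exp (B * of_real (ln (r / \<sigma>))) / of_real r)" for r
    using R by (auto simp: h_def indicator_def powr_minus field_simps scaleR_conv_of_real power2_eq_square power3_eq_cube powr_numeral)
  have "set_integrable lborel {0<..} (\<lambda>r. r\<^sup>2 *\<^sub>R h r)"
    using set_integrable_Ioi_exp_ln[OF R \<sigma> B] unfolding set_integrable_def eq .
  note 2 = integral_radial_angular[OF f h this, of y]
  have 3: "f (sgn (x - y)) *\<^sub>R h (norm (x - y)) = u x" for x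
  proof (cases "norm (x - y) > R")
    case True
    then have "norm (x - y) / \<sigma> > 0" using R \<sigma> by (intro divide_pos_pos) linarith+
    then show ?thesis
      by (simp add: h_def u_def complex_powr_of_real scaleR_conv_of_real mult_ac del: of_real_divide)
  qed (simp add: h_def u_def)
  show "integrable lborel u" using 2(1) unfolding 3 .
  show "(LINT x|lborel. u x) = - of_real (solid_angle_integral f) * exp (B * of_real (ln (R / \<sigma>))) / B"
    using 2(2) integral_Ioi_exp_ln[OF R \<sigma> B] unfolding 3 set_lebesgue_integral_def eq
    by (simp add: scaleR_conv_of_real)
qed

subsection \<open>Coefficients of radial expansions\<close>

text \<open>
  \<open>G r - 2 powr a * G (r / 2)\<close> has no term of exponent \<open>a\<close> and multiplies the other coefficients by
  nonzero constants, which gives an induction on the number of exponents.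
\<close>

lemma continuous_on_expansion_coefficients:
  fixes f :: "real \<Rightarrow> 'a::topological_space \<Rightarrow> real" and N :: real
  assumes "finite A" and "\<And>a. a \<in> A \<Longrightarrow> a \<le> N" and "\<delta> > 0"
    and "\<And>r. 0 < r \<Longrightarrow> r < \<delta> \<Longrightarrow> continuous_on K (G r)"
    and "uniform_limit K (\<lambda>r n. (G r n - (\<Sum>a\<in>A. r powr a * f a n)) / r powr N) (\<lambda>n. 0) (at_right 0)"
    and "c \<in> A"
  shows "continuous_on K (f c)"
  using assms
proof (induction A arbitrary: G f \<delta> c rule: finite_induct)
  case (insert a A)
  let ?e = "\<lambda>r n. (G r n - (\<Sum>a\<in>insert a A. r powr a * f a n)) / r powr N"
  define G' where "G' r n = G r n - 2 powr a * G (r / 2) n" for r n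
  define f' where "f' b n = (1 - 2 powr (a - b)) * f b n" for b n
  have half: "filterlim (\<lambda>r::real. r / 2) (at_right 0) (at_right 0)"
    unfolding filterlim_at
    by (auto intro!: tendsto_eq_intros eventually_at_rightI[of 0 1])
  have lim: "uniform_limit K ?e (\<lambda>n. 0) (at_right 0)" by (rule insert.prems)
  have lim2: "uniform_limit K (\<lambda>r. ?e (r / 2)) (\<lambda>n. 0) (at_right 0)"
    by (rule filterlim_compose[OF lim half])
  \<comment> \<open>The remainder at \<open>r / 2\<close> has the denominator
    \<open>(r / 2) powr N\<close>; the factor \<open>2 powr (a - N)\<close> turns it into
    \<open>2 powr a\<close> over \<open>r powr N\<close>, as \<open>G'\<close> requires.\<close>
  have lim3: "uniform_limit K (\<lambda>r n. ?e r n - 2 powr (a - N) * ?e (r / 2) n) (\<lambda>n. 0 - 2 powr (a - N) * 0) (at_right 0)"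
    by (intro uniform_limit_intros lim lim2 bounded_linear.uniform_limit[OF bounded_linear_mult_right])
  have eq: "?e r n - 2 powr (a - N) * ?e (r / 2) n = (G' r n - (\<Sum>b\<in>A. r powr b * f' b n)) / r powr N"
    if r: "r > 0" for r n
  proof -
    have half_powr: "2 powr a * ((r / 2) powr b * t) = r powr b * (2 powr (a - b) * t)" for b t
    proof -
      have "(r / 2) powr b = r powr b / 2 powr b" using r by (simp add: powr_divide)
      then show ?thesis by (simp add: powr_diff)
    qed
    have "2 powr (a - N) * ?e (r / 2) n
        = 2 powr a * (G (r / 2) n - (\<Sum>b\<in>insert a A. (r / 2) powr b * f b n)) / r powr N"
      using r by (simp add: powr_divide powr_diff)
    also have "\<dots> = (2 powr a * G (r / 2) n - (\<Sum>b\<in>insert a A. r powr b * (2 powr (a - b) * f b n))) / r powr N"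
      by (simp add: right_diff_distrib sum_distrib_left half_powr distrib_left)
    finally show ?thesis using insert.hyps
      by (simp add: G'_def f'_def diff_divide_distrib[symmetric] add_divide_distrib[symmetric] algebra_simps sum.distrib sum_subtractf)
  qed
  have contf: "continuous_on K (f b)" if b: "b \<in> A" for b
  proof -
    have "continuous_on K (f' b)"
    proof (rule insert.IH)
      show "b \<le> N" if "b \<in> A" for b using insert.prems that by auto
      show "\<delta> > 0" by (rule insert.prems)
      show "continuous_on K (G' r)" if "0 < r" "r < \<delta>" for r
        unfolding G'_def by (intro continuous_intros insert.prems) (use that in auto)
      show "uniform_limit K (\<lambda>r n. (G' r n - (\<Sum>b\<in>A. r powr b * f' b n)) / r powr N) (\<lambda>n. 0) (at_right 0)"
      proof (rule uniform_limit_cong[THEN iffD1, OF _ _ lim3])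
        have "\<forall>\<^sub>F r in at_right (0::real). r \<in> {0<..<1}"
          by (rule eventually_at_right_real) simp
        then show "\<forall>\<^sub>F r in at_right 0. \<forall>n\<in>K. ?e r n - 2 powr (a - N) * ?e (r / 2) n
            = (G' r n - (\<Sum>b\<in>A. r powr b * f' b n)) / r powr N"
        proof eventually_elim
          case (elim r)
          then have "r > 0" by simp
          then show ?case using eq by blast
        qed
      qed simp
    qed (rule b)
    \<comment> \<open>\<open>a\<close> is not in \<open>A\<close>, so \<open>b\<close> differs from
      \<open>a\<close> and the factor can be divided out.\<close>
    moreover have "1 - 2 powr (a - b) \<noteq> (0::real)" using b insert.hyps by auto
    ultimately have "continuous_on K (\<lambda>n. f' b n / (1 - 2 powr (a - b)))"
      by (intro continuous_intros) auto
    with \<open>1 - 2 powr (a - b) \<noteq> (0::real)\<close> show ?thesis by (simp add: f'_def)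
  qed
  \<comment> \<open>With the other coefficients continuous, \<open>f a\<close> is a uniform limit of
    continuous functions: the error is \<open>r powr (N - a)\<close> times the remainder, and
    \<open>a \<le> N\<close>.\<close>
  have "continuous_on K (f a)"
  proof (rule uniform_limit_theorem)
    show "\<forall>\<^sub>F r in at_right (0::real). continuous_on K (\<lambda>n. r powr (- a) * (G r n - (\<Sum>b\<in>A. r powr b * f b n)))"
      by (rule eventually_at_rightI[of 0 \<delta>])
         (use \<open>\<delta> > 0\<close> in \<open>auto intro!: continuous_intros contf insert.prems\<close>)
    show "uniform_limit K (\<lambda>r n. r powr (- a) * (G r n - (\<Sum>b\<in>A. r powr b * f b n))) (f a) (at_right 0)"
    proof (rule uniform_limitI)
      fix \<epsilon> :: real assume "\<epsilon> > 0"
      have ev: "\<forall>\<^sub>F r in at_right (0::real). r \<in> {0<..<1}"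
        by (rule eventually_at_right_real) simp
      show "\<forall>\<^sub>F r in at_right 0. \<forall>n\<in>K. dist (r powr (- a) * (G r n - (\<Sum>b\<in>A. r powr b * f b n))) (f a n) < \<epsilon>"
        using uniform_limitD[OF lim \<open>\<epsilon> > 0\<close>] ev
      proof eventually_elim
        case (elim r)
        show ?case
        proof
          fix n assume n: "n \<in> K"
          have r: "0 < r" "r < 1" using elim by auto
          have "r powr (- a) * (G r n - (\<Sum>b\<in>A. r powr b * f b n)) - f a n = r powr (N - a) * ?e r n"
            using r insert.hyps by (simp add: powr_diff powr_minus field_simps)
          then have "dist (r powr (- a) * (G r n - (\<Sum>b\<in>A. r powr b * f b n))) (f a n) = r powr (N - a) * \<bar>?e r n\<bar>"
            by (simp add: dist_real_def abs_mult)
          also have "\<dots> \<le> 1 * \<bar>?e r n\<bar>"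
            using r insert.prems by (intro mult_right_mono powr_le1) auto
          also have "\<dots> < \<epsilon>" using elim n by (auto simp: dist_real_def)
          finally show "dist (r powr (- a) * (G r n - (\<Sum>b\<in>A. r powr b * f b n))) (f a n) < \<epsilon>" .
        qed
      qed
    qed
  qed simp
  then show ?case using contf insert.prems by auto
qed simp

text \<open>The definition of an expansion does not ask for continuous coefficients; they inherit
  continuity from \<open>F\<close> on small spheres. Their later measurability and boundedness rest
  on this.\<close>

lemma has_radial_expansion_continuous:
  assumes exp: "has_radial_expansion F y A f" and \<delta>: "\<delta> > 0" and F: "continuous_on (ball y \<delta> - {y}) F"
  shows "continuous_on (sphere 0 1) (f a)"
proof (cases "a \<in> A")
  case True
  obtain N :: nat where N: "a \<le> real N" using real_arch_simple by blast
  show ?thesis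
  proof (rule continuous_on_expansion_coefficients)
    show "finite {a \<in> A. a \<le> real N}" using exp by (simp add: has_radial_expansion_def)
    show "continuous_on (sphere 0 1) (\<lambda>n. F (y + r *\<^sub>R n))" if "0 < r" "r < \<delta>" for r
      by (rule continuous_on_compose2[OF F]) (use that in \<open>auto intro!: continuous_intros simp: dist_norm\<close>)
    have "uniform_limit (sphere 0 1)
        (\<lambda>r n. (F (y + r *\<^sub>R n) - (\<Sum>a\<in>{a\<in>A. a \<le> real N}. r powr a * f a n)) / r ^ N) (\<lambda>n. 0) (at_right 0)"
      using exp by (simp add: has_radial_expansion_def)
    then show "uniform_limit (sphere 0 1)
        (\<lambda>r n. (F (y + r *\<^sub>R n) - (\<Sum>a\<in>{a\<in>A. a \<le> real N}. r powr a * f a n)) / r powr real N) (\<lambda>n. 0) (at_right 0)"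
      by (rule uniform_limit_cong[THEN iffD1, rotated 2])
         (auto intro!: eventually_at_rightI[of 0 1] simp: powr_realpow)
  qed (use N \<delta> True in auto)
next
  case False
  then have "f a n = 0" if "n \<in> sphere 0 1" for n
    using exp that by (auto simp: has_radial_expansion_def)
  then show ?thesis
    by (subst continuous_on_cong[where g = "\<lambda>_. 0"]) auto
qed

section \<open>The singular part of an expansion and its integrals\<close>

definition singular_part :: "real^3 \<Rightarrow> real set \<Rightarrow> (real \<Rightarrow> real^3 \<Rightarrow> real) \<Rightarrow> real^3 \<Rightarrow> real" where
  "singular_part y A f x = (\<Sum>a\<in>{a\<in>A. a + 3 \<le> 0}. norm (x - y) powr a * f a (sgn (x - y)))"

text \<open>The exponent \<open>-3\<close> is set apart because its radial integral is a logarithm,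
  divergent both at the centre and at infinity.\<close>

definition log_part :: "real^3 \<Rightarrow> (real \<Rightarrow> real^3 \<Rightarrow> real) \<Rightarrow> real^3 \<Rightarrow> real" where
  "log_part y f x = norm (x - y) powr -3 * f (-3) (sgn (x - y))"

definition power_part :: "real^3 \<Rightarrow> real set \<Rightarrow> (real \<Rightarrow> real^3 \<Rightarrow> real) \<Rightarrow> real^3 \<Rightarrow> real" where
  "power_part y A f x = (\<Sum>a\<in>{a\<in>A. a + 3 < 0}. norm (x - y) powr a * f a (sgn (x - y)))"

lemma subtract_singular_eq: "subtract_singular y A f F x = F x - singular_part y A f x"
  by (simp add: subtract_singular_def singular_part_def)

lemma finite_exponents:
  assumes "has_radial_expansion F y A f"
  shows "finite {a\<in>A. a + 3 \<le> 0}" "finite {a\<in>A. a + 3 < 0}" "finite {a\<in>A. a \<le> 0}"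
proof -
  have fin: "finite {a\<in>A. a \<le> c}" for c using assms by (simp add: has_radial_expansion_def)
  show "finite {a\<in>A. a + 3 \<le> 0}" "finite {a\<in>A. a + 3 < 0}" "finite {a\<in>A. a \<le> 0}"
    by (rule finite_subset[OF _ fin[of 0]]; auto)+
qed

text \<open>If \<open>-3\<close> is not an exponent, \<open>f (-3)\<close> is zero on the sphere, so
  \<open>log_part\<close> vanishes off the centre; at the centre it vanishes because
  \<open>0 powr -3\<close> is \<open>0\<close>.\<close>

lemma singular_part_split:
  assumes "has_radial_expansion F y A f"
  shows "singular_part y A f x = power_part y A f x + log_part y f x"
proof (cases "-3 \<in> A")
  case True
  then have "{a\<in>A. a + 3 \<le> 0} = insert (-3) {a\<in>A. a + 3 < 0}" by force
  then show ?thesis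
    using finite_exponents(2)[OF assms] by (simp add: singular_part_def power_part_def log_part_def)
next
  case False
  then have "a + 3 \<le> 0 \<longleftrightarrow> a + 3 < 0" if "a \<in> A" for a
    using that by (cases "a = -3") auto
  then have "{a\<in>A. a + 3 \<le> 0} = {a\<in>A. a + 3 < 0}" by blast
  moreover have "log_part y f x = 0"
  proof (cases "x = y")
    case False
    then have "sgn (x - y) \<in> sphere 0 1" by (simp add: norm_sgn)
    with assms \<open>-3 \<notin> A\<close> show ?thesis by (auto simp: log_part_def has_radial_expansion_def)
  qed (simp add: log_part_def)
  ultimately show ?thesis by (simp add: singular_part_def power_part_def)
qed

text \<open>Integrating \<open>r powr (a + 2)\<close> from \<open>s\<close> to \<open>\<rho>\<close>
  yields the differences of the terms of the counterterm, with the logarithm for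
  \<open>a = -3\<close>; the scale \<open>\<sigma>\<close> cancels.\<close>

lemma
  fixes y :: "real^3"
  assumes exp: "has_radial_expansion F y A f" and cont: "\<And>a. continuous_on (sphere 0 1) (f a)"
    and s: "0 < s" "s \<le> \<rho>" and \<sigma>: "\<sigma> > 0"
  shows integrable_singular_part_shell:
      "integrable lborel (\<lambda>x. indicator {s<..\<rho>} (norm (x - y)) * singular_part y A f x)"
    and integral_singular_part_shell:
      "(LINT x|lborel. indicator {s<..\<rho>} (norm (x - y)) * singular_part y A f x)
        = Pf_counterterm A f \<sigma> \<rho> - Pf_counterterm A f \<sigma> s"
proof -
  let ?t = "\<lambda>a x. indicator {s<..\<rho>} (norm (x - y)) * (norm (x - y) powr a * f a (sgn (x - y)))"
  have S: "{s<..\<rho>} \<in> sets borel" "{s<..\<rho>} \<subseteq> {0<..}" using s by auto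
  note int = integrable_powr_angular[OF cont S has_integral_Ioc_powr[OF s]]
    and val = integral_powr_angular[OF cont S has_integral_Ioc_powr[OF s]]
  have eq: "indicator {s<..\<rho>} (norm (x - y)) * singular_part y A f x = (\<Sum>a\<in>{a\<in>A. a + 3 < 0}. ?t a x) + ?t (-3) x" for x
    by (simp add: singular_part_split[OF exp] power_part_def log_part_def distrib_left sum_distrib_left)
  show "integrable lborel (\<lambda>x. indicator {s<..\<rho>} (norm (x - y)) * singular_part y A f x)"
    unfolding eq by (intro Bochner_Integration.integrable_add Bochner_Integration.integrable_sum int)
  have "(LINT x|lborel. indicator {s<..\<rho>} (norm (x - y)) * singular_part y A f x)
    = (\<Sum>a\<in>{a\<in>A. a + 3 < 0}. LINT x|lborel. ?t a x) + (LINT x|lborel. ?t (-3) x)"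
    unfolding eq by (simp add: int Bochner_Integration.integral_add Bochner_Integration.integral_sum Bochner_Integration.integrable_sum)
  also have "\<dots> = (\<Sum>a\<in>{a\<in>A. a + 3 < 0}. solid_angle_integral (f a) * ((\<rho> powr (a + 3) - s powr (a + 3)) / (a + 3)))
      + solid_angle_integral (f (-3)) * ln (\<rho> / s)"
    unfolding val by (intro arg_cong2[where f="(+)"] sum.cong) (auto simp: add.assoc)
  also have "\<dots> = Pf_counterterm A f \<sigma> \<rho> - Pf_counterterm A f \<sigma> s"
    unfolding Pf_counterterm_def using s \<sigma>
    by (simp add: ln_div algebra_simps diff_divide_distrib sum_subtractf)
  finally show "(LINT x|lborel. indicator {s<..\<rho>} (norm (x - y)) * singular_part y A f x)
        = Pf_counterterm A f \<sigma> \<rho> - Pf_counterterm A f \<sigma> s" .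
qed

(* The subtracted terms outside radius \<rho>; the one of exponent -3 is cut off at R because it is not
   integrable at infinity. *)
definition outer_part :: "real \<Rightarrow> real \<Rightarrow> real^3 \<Rightarrow> real set \<Rightarrow> (real \<Rightarrow> real^3 \<Rightarrow> real) \<Rightarrow> real^3 \<Rightarrow> real" where
  "outer_part \<rho> R y A f x = indicator {\<rho><..} (norm (x - y)) * power_part y A f x
     + indicator {\<rho><..R} (norm (x - y)) * log_part y f x"

text \<open>Exponents below \<open>-3\<close> contribute only at the endpoint \<open>\<rho>\<close>,
  and the exponent \<open>-3\<close> gives \<open>ln (R / \<rho>)\<close>. The cutoff
  \<open>R\<close> thus takes the place of the length scale in the counterterm.\<close>

lemma
  fixes y :: "real^3"
  assumes cont: "\<And>a. continuous_on (sphere 0 1) (f a)" and \<rho>: "0 < \<rho>" "\<rho> \<le> R"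
  shows integrable_outer_part: "integrable lborel (outer_part \<rho> R y A f)"
    and integral_outer_part:
      "(LINT x|lborel. outer_part \<rho> R y A f x) = - Pf_counterterm A f R \<rho>"
proof -
  let ?t = "\<lambda>S a x. indicator S (norm (x - y)) * (norm (x - y) powr a * f a (sgn (x - y)))"
  have S: "{\<rho><..R} \<in> sets borel" "{\<rho><..R} \<subseteq> {0<..}" "{\<rho><..} \<in> sets borel" "{\<rho><..} \<subseteq> {0<..}" using \<rho> by auto
  note int = integrable_powr_angular[OF cont S(1,2) has_integral_Ioc_powr[OF \<rho>]]
    and val = integral_powr_angular[OF cont S(1,2) has_integral_Ioc_powr[OF \<rho>]]
  have int': "integrable lborel (?t {\<rho><..} a)" 
    and val': "(LINT x|lborel. ?t {\<rho><..} a x) = solid_angle_integral (f a) * - (\<rho> powr (a + 3) / (a + 3))" if "a + 3 < 0" for a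
    using integrable_powr_angular[OF cont S(3,4) has_integral_Ioi_powr[OF \<rho>(1), of "a + 2"]]
       integral_powr_angular[OF cont S(3,4) has_integral_Ioi_powr[OF \<rho>(1), of "a + 2"]] that
    by (auto simp: add.assoc)
  have eq: "outer_part \<rho> R y A f x = (\<Sum>a\<in>{a\<in>A. a + 3 < 0}. ?t {\<rho><..} a x) + ?t {\<rho><..R} (-3) x" for x
    by (simp add: outer_part_def power_part_def log_part_def sum_distrib_left)
  show "integrable lborel (outer_part \<rho> R y A f)"
    unfolding eq[abs_def] by (intro Bochner_Integration.integrable_add Bochner_Integration.integrable_sum int int') auto
  have "(LINT x|lborel. outer_part \<rho> R y A f x)
    = (\<Sum>a\<in>{a\<in>A. a + 3 < 0}. LINT x|lborel. ?t {\<rho><..} a x) + (LINT x|lborel. ?t {\<rho><..R} (-3) x)"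
    unfolding eq by (subst Bochner_Integration.integral_add) (auto simp: int int' Bochner_Integration.integral_sum intro!: Bochner_Integration.integrable_sum)
  also have "\<dots> = (\<Sum>a\<in>{a\<in>A. a + 3 < 0}. solid_angle_integral (f a) * - (\<rho> powr (a + 3) / (a + 3)))
      + solid_angle_integral (f (-3)) * ln (R / \<rho>)"
    unfolding val by (intro arg_cong2[where f="(+)"] sum.cong val') auto
  also have "\<dots> = - Pf_counterterm A f R \<rho>"
    unfolding Pf_counterterm_def using \<rho>
    by (simp add: ln_div algebra_simps sum_negf)
  finally show "(LINT x|lborel. outer_part \<rho> R y A f x) = - Pf_counterterm A f R \<rho>" .
qed

text \<open>The expansion at order \<open>N = 0\<close> suffices: its remainder tends to zero
  uniformly, hence is at most \<open>1\<close> near the centre.\<close>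

lemma has_radial_expansion_near:
  assumes "has_radial_expansion F y A f"
  obtains \<delta> where "\<delta> > 0" and
    "\<And>x. 0 < norm (x - y) \<Longrightarrow> norm (x - y) < \<delta> \<Longrightarrow>
       \<bar>F x - (\<Sum>a\<in>{a\<in>A. a \<le> 0}. norm (x - y) powr a * f a (sgn (x - y)))\<bar> \<le> 1"
proof -
  have lim: "uniform_limit (sphere 0 1)
        (\<lambda>r n. F (y + r *\<^sub>R n) - (\<Sum>a\<in>{a\<in>A. a \<le> 0}. r powr a * f a n)) (\<lambda>n. 0) (at_right 0)"
    using assms[unfolded has_radial_expansion_def, THEN conjunct2, THEN conjunct2, THEN spec, of 0] by simp
  obtain \<delta> where \<delta>: "\<delta> > 0" and b: "\<And>r n. 0 < r \<Longrightarrow> r < \<delta> \<Longrightarrow> n \<in> sphere 0 1 \<Longrightarrow>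
      \<bar>F (y + r *\<^sub>R n) - (\<Sum>a\<in>{a\<in>A. a \<le> 0}. r powr a * f a n)\<bar> < 1"
    using uniform_limitD[OF lim zero_less_one]
    unfolding eventually_at_right_field by (auto simp: dist_real_def)
  show ?thesis
  proof (rule that[OF \<delta>])
    fix x assume x: "0 < norm (x - y)" "norm (x - y) < \<delta>"
    have "y + norm (x - y) *\<^sub>R sgn (x - y) = x" using x by (simp add: sgn_div_norm)
    then show "\<bar>F x - (\<Sum>a\<in>{a\<in>A. a \<le> 0}. norm (x - y) powr a * f a (sgn (x - y)))\<bar> \<le> 1"
      using b[OF x, of "sgn (x - y)"] x by (simp add: norm_sgn)
  qed
qed

lemma borel_measurable_powr_angular:
  assumes "continuous_on (sphere 0 1) (f :: real^3 \<Rightarrow> real)"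
  shows "(\<lambda>x. norm (x - y) powr a * f (sgn (x - y))) \<in> borel_measurable borel"
  using borel_measurable_sgn_comp[OF assms, of y] by measurable

text \<open>After the subtraction there remain the bounded remainder of order zero and the exponents
  in \<open>(-3, 0]\<close>, for which \<open>r powr (a + 2)\<close> is integrable at the
  origin.\<close>

lemma integrable_near_subtract_singular:
  fixes y :: "real^3"
  assumes exp: "has_radial_expansion F y A f" and cont: "\<And>a. continuous_on (sphere 0 1) (f a)"
    and F [measurable]: "F \<in> borel_measurable borel"
    and b: "\<And>x. 0 < norm (x - y) \<Longrightarrow> norm (x - y) \<le> \<rho> \<Longrightarrow>
       \<bar>F x - (\<Sum>a\<in>{a\<in>A. a \<le> 0}. norm (x - y) powr a * f a (sgn (x - y)))\<bar> \<le> 1"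
    and \<rho>: "\<rho> > 0"
  shows "integrable lborel (\<lambda>x. indicator {..\<rho>} (norm (x - y)) * (F x - singular_part y A f x))"
proof -
  note [measurable] = borel_measurable_powr_angular[OF cont]
  let ?p = "\<lambda>a x. norm (x - y) powr a * f a (sgn (x - y))"
  let ?D = "\<lambda>x. F x - (\<Sum>a\<in>{a\<in>A. a \<le> 0}. ?p a x)"
  have 1: "integrable lborel (\<lambda>x. indicator {..\<rho>} (norm (x - y)) * ?D x)"
  proof (rule Bochner_Integration.integrable_bound)
    have "emeasure lborel (cball y \<rho>) < \<infinity>" by (rule emeasure_lborel_cball_finite)
    then show "integrable lborel (indicator (cball y \<rho>) :: _ \<Rightarrow> real)"
      by (simp add: integrable_indicator_iff)
    show "AE x in lborel. norm (indicator {..\<rho>} (norm (x - y)) * ?D x) \<le> norm (indicator (cball y \<rho>) x :: real)"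
      using AE_lborel_singleton[of y]
      by eventually_elim (use b in \<open>auto simp: indicator_def dist_norm norm_minus_commute\<close>)
  qed measurable
  have 2: "integrable lborel (\<lambda>x. indicator {0<..\<rho>} (norm (x - y)) * ?p a x)" if a: "a > -3" for a
  proof (rule integrable_powr_angular[OF cont])
    have "((\<lambda>r. r powr (a + 2)) has_integral \<rho> powr (a + 2 + 1) / (a + 2 + 1)) {0..\<rho>}"
      by (rule has_integral_powr_from_0) (use a \<rho> in auto)
    then show "((\<lambda>r. r powr (a + 2)) has_integral \<rho> powr (a + 2 + 1) / (a + 2 + 1)) {0<..\<rho>}"
      by (subst has_integral_spike_set_eq[of _ "{0..\<rho>}"]) (auto intro: negligible_subset[of "{0}"])
  qed auto
  have fin: "finite {a\<in>A. a \<le> 0}" by (rule finite_exponents[OF exp])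
  have split: "{a\<in>A. a \<le> 0} = {a\<in>A. a + 3 \<le> 0} \<union> {a\<in>A. -3 < a \<and> a \<le> 0}" by auto
  have sum_eq: "(\<Sum>a\<in>{a\<in>A. a \<le> 0}. ?p a x) = singular_part y A f x + (\<Sum>a\<in>{a\<in>A. -3 < a \<and> a \<le> 0}. ?p a x)" for x
    unfolding singular_part_def split
    by (rule sum.union_disjoint) (auto intro: finite_subset[OF _ fin])
  \<comment> \<open>The centre fits this identity because \<open>0 powr a\<close> is
    \<open>0\<close>.\<close>
  have "indicator {..\<rho>} (norm (x - y)) * (F x - singular_part y A f x) = indicator {..\<rho>} (norm (x - y)) * ?D x
      + (\<Sum>a\<in>{a\<in>A. -3 < a \<and> a \<le> 0}. indicator {0<..\<rho>} (norm (x - y)) * ?p a x)" for x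
  proof (cases "x = y")
    case True
    then show ?thesis by (simp add: singular_part_def)
  next
    case False
    then show ?thesis by (auto simp: sum_eq indicator_def algebra_simps)
  qed
  moreover have "integrable lborel (\<lambda>x. indicator {..\<rho>} (norm (x - y)) * ?D x
      + (\<Sum>a\<in>{a\<in>A. -3 < a \<and> a \<le> 0}. indicator {0<..\<rho>} (norm (x - y)) * ?p a x))"
    by (intro Bochner_Integration.integrable_add 1 Bochner_Integration.integrable_sum 2) auto
  ultimately show ?thesis by simp
qed

subsection \<open>Analytic continuation\<close>

text \<open>Cauchy's inequality turns a local majorant of \<open>D\<close> into one for its
  derivative in \<open>B\<close>, hence for the difference quotients, and dominated convergence
  differentiates under the integral.\<close>

lemma holomorphic_on_lebesgue_integral:
  fixes D :: "complex \<Rightarrow> 'a \<Rightarrow> complex"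
  assumes meas: "\<And>B. B \<in> U \<Longrightarrow> D B \<in> borel_measurable M"
    and hol: "\<And>x. x \<in> space M \<Longrightarrow> (\<lambda>B. D B x) holomorphic_on U"
    and dom: "\<And>B0. B0 \<in> U \<Longrightarrow> \<exists>r>0. \<exists>g. cball B0 r \<subseteq> U \<and> integrable M g \<and>
      (\<forall>B\<in>cball B0 r. \<forall>x\<in>space M. norm (D B x) \<le> g x)"
  shows "(\<lambda>B. LINT x|M. D B x) holomorphic_on U"
proof (rule holomorphic_onI)
  fix B0 assume B0: "B0 \<in> U"
  obtain r g where r: "r > 0" "cball B0 r \<subseteq> U" and g: "integrable M g"
    and b: "\<And>B x. B \<in> cball B0 r \<Longrightarrow> x \<in> space M \<Longrightarrow> norm (D B x) \<le> g x"
    using dom[OF B0] by blast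
  have hol': "(\<lambda>B. D B x) holomorphic_on cball B0 r" if "x \<in> space M" for x
    using hol[OF that] r(2) by (rule holomorphic_on_subset)
  have int: "integrable M (D B)" if "B \<in> cball B0 r" for B
    by (rule Bochner_Integration.integrable_bound[OF g meas])
       (use that r b in \<open>auto intro!: AE_I2 order_trans[OF _ abs_ge_self]\<close>)
  \<comment> \<open>Half the radius leaves room for a circle of radius \<open>r / 2\<close> around
    every point of \<open>?S\<close>, on which \<open>g\<close> still bounds
    \<open>D\<close>.\<close>
  let ?S = "ball B0 (r / 2)"
  let ?D' = "\<lambda>x. deriv (\<lambda>B. D B x) B0"
  have der: "((\<lambda>B. D B x) has_field_derivative deriv (\<lambda>B. D B x) z) (at z)" if "x \<in> space M" "z \<in> ball B0 r" for x z
    by (rule holomorphic_derivI[of _ "ball B0 r"])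
       (use holomorphic_on_subset[OF hol'[OF that(1)] ball_subset_cball] that in auto)
  have lip: "norm (D z x - D B0 x) \<le> (g x / (r / 2)) * norm (z - B0)" if x: "x \<in> space M" and z: "z \<in> ?S" for x z
  proof (rule field_differentiable_bound[of ?S])
    fix w assume w: "w \<in> ?S"
    have sub: "cball w (r / 2) \<subseteq> ball B0 r"
    proof
      fix u assume "u \<in> cball w (r / 2)"
      then have "dist B0 u \<le> dist B0 w + r / 2" using dist_triangle[of B0 u w] by simp
      then show "u \<in> ball B0 r" using w by simp
    qed
    show "((\<lambda>B. D B x) has_field_derivative deriv (\<lambda>B. D B x) w) (at w within ?S)"
      by (rule has_field_derivative_at_within[OF der[OF x]]) (use w r in auto)
    have h: "(\<lambda>B. D B x) holomorphic_on cball w (r / 2)"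
      by (rule holomorphic_on_subset[OF hol'[OF x]]) (use sub in auto)
    have "norm ((deriv ^^ 1) (\<lambda>B. D B x) w) \<le> fact 1 * g x / (r / 2) ^ 1"
    proof (rule Cauchy_inequality)
      show "(\<lambda>B. D B x) holomorphic_on ball w (r / 2)"
        by (rule holomorphic_on_subset[OF h ball_subset_cball])
      show "continuous_on (cball w (r / 2)) (\<lambda>B. D B x)"
        by (rule holomorphic_on_imp_continuous_on[OF h])
      show "norm (D u x) \<le> g x" if "norm (w - u) = r / 2" for u
        by (rule b) (use sub that x in \<open>auto simp: subset_eq dist_norm intro!: less_imp_le\<close>)
    qed (use r in auto)
    then show "norm (deriv (\<lambda>B. D B x) w) \<le> g x / (r / 2)" by simp
  qed (use r z in auto)
  have "((\<lambda>B. ((LINT x|M. D B x) - (LINT x|M. D B0 x)) / (B - B0)) \<longlongrightarrow> (LINT x|M. ?D' x)) (at B0 within ?S)"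
    unfolding tendsto_at_iff_sequentially
  proof (intro allI impI)
    fix X assume X: "\<forall>i. X i \<in> ?S - {B0}" and lim: "X \<longlonglongrightarrow> B0"
    have q: "(\<lambda>i. (D (X i) x - D B0 x) / (X i - B0)) \<longlonglongrightarrow> ?D' x" if "x \<in> space M" for x
    proof -
      have "((\<lambda>B. (D B x - D B0 x) / (B - B0)) \<longlongrightarrow> ?D' x) (at B0)"
        using der[OF that, of B0] r(1) by (simp add: has_field_derivative_iff)
      then show ?thesis
        using X lim unfolding tendsto_at_iff_sequentially[of _ _ _ UNIV, simplified] by (auto simp: o_def)
    qed
    have XU: "X i \<in> cball B0 r" for i using X r(1) by (auto dest!: spec[of _ i])
    then have [measurable]: "D (X i) \<in> borel_measurable M" for i using meas r(2) by blast
    have [measurable]: "D B0 \<in> borel_measurable M" by (rule meas[OF B0])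
    have "(\<lambda>i. LINT x|M. (D (X i) x - D B0 x) / (X i - B0)) \<longlonglongrightarrow> (LINT x|M. ?D' x)"
    proof (rule integral_dominated_convergence)
      show "?D' \<in> borel_measurable M"
        by (rule borel_measurable_LIMSEQ_metric[OF _ q]) auto
      show "integrable M (\<lambda>x. g x / (r / 2))" using g by simp
      show "AE x in M. (\<lambda>i. (D (X i) x - D B0 x) / (X i - B0)) \<longlonglongrightarrow> ?D' x"
        by (rule AE_I2) (rule q)
      show "AE x in M. norm ((D (X i) x - D B0 x) / (X i - B0)) \<le> g x / (r / 2)" for i
      proof (rule AE_I2)
        fix x assume x: "x \<in> space M"
        have "X i \<in> ?S" "X i \<noteq> B0" using X by auto
        with lip[OF x, of "X i"] show "norm ((D (X i) x - D B0 x) / (X i - B0)) \<le> g x / (r / 2)"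
          by (simp add: norm_divide pos_divide_le_eq)
      qed
    qed auto
    moreover have "(LINT x|M. (D (X i) x - D B0 x) / (X i - B0))
        = ((LINT x|M. D (X i) x) - (LINT x|M. D B0 x)) / (X i - B0)" for i
      using int[OF XU[of i]] int[of B0] r(1) by simp
    ultimately show "((\<lambda>B. ((LINT x|M. D B x) - (LINT x|M. D B0 x)) / (B - B0)) \<circ> X) \<longlonglongrightarrow> (LINT x|M. ?D' x)"
      by (simp only: o_def)
  qed
  then have "((\<lambda>B. LINT x|M. D B x) has_field_derivative (LINT x|M. ?D' x)) (at B0)"
    using r(1) by (simp add: has_field_derivative_iff at_within_open[of B0 ?S])
  then show "(\<lambda>B. LINT x|M. D B x) field_differentiable at B0 within U"
    using field_differentiable_at_within field_differentiable_def by blast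
qed

section \<open>The finite part at a simple pole, and elementary estimates\<close>

text \<open>Near \<open>0\<close> the term \<open>w * exp (l * B) / B\<close> is
  \<open>w / B + w * l\<close> up to \<open>O(B)\<close>, so it adds \<open>w * l\<close> to the
  constant coefficient.\<close>

lemma has_FP_simple_pole:
  assumes \<kappa>: "\<kappa> > 0" and E: "E holomorphic_on {B. Re B < \<kappa>}"
    and I: "\<And>B. Re B < 0 \<Longrightarrow> I B = E B + w * exp (l * B) / B"
  shows "has_FP I (E 0 + w * l)"
proof -
  define L where "L = fps_to_fls (fps_expansion E 0) + fls_const w * (fls_X_inv * fps_to_fls (fps_exp l))"
  define g where "g B = E B + w * (inverse B * exp (l * B))" for B
  have "open {B. Re B < \<kappa>}" by (rule open_halfspace_Re_lt)
  moreover have "0 \<in> {B. Re B < \<kappa>}" using \<kappa> by simp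
  ultimately have "E analytic_on {0}"
    using E analytic_at by blast
  then have "E has_laurent_expansion fps_to_fls (fps_expansion E 0)"
    by (intro has_laurent_expansion_fps analytic_at_imp_has_fps_expansion_0)
  moreover have "(\<lambda>B. exp (l * B)) has_laurent_expansion fps_to_fls (fps_exp l)"
    by (rule has_laurent_expansion_fps[OF has_fps_expansion_exp])
  ultimately have L: "g has_laurent_expansion L"
    unfolding g_def[abs_def] L_def
    by (intro has_laurent_expansion_add has_laurent_expansion_mult has_laurent_expansion_const
        has_laurent_expansion_fls_X_inv)
  \<comment> \<open>The disc of radius \<open>\<kappa>\<close> lies in the half plane, so
    \<open>\<kappa>\<close> can serve as \<open>\<delta>\<close> in \<open>has_FP\<close>.\<close>
  have "Re B < \<kappa>" if "norm B < \<kappa>" for B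
    using complex_Re_le_cmod[of B] that by linarith
  then have "E holomorphic_on {B. Re B < 0} \<union> (ball 0 \<kappa> - {0})"
    by (intro holomorphic_on_subset[OF E]) (use \<kappa> in auto)
  moreover have "(\<lambda>B. exp (l * B)) holomorphic_on S" for S
    by (intro holomorphic_intros)
  ultimately have "g holomorphic_on {B. Re B < 0} \<union> (ball 0 \<kappa> - {0})"
    unfolding g_def[abs_def]
    by (intro holomorphic_on_add holomorphic_on_mult holomorphic_on_const holomorphic_on_inverse
        holomorphic_on_ident) auto
  moreover have "\<forall>B. Re B < 0 \<longrightarrow> g B = I B"
    using I by (simp add: g_def field_simps)
  moreover have "fls_nth L 0 = E 0 + w * l"
    by (simp add: L_def fls_X_inv_times_conv_shift fps_expansion_def)
  ultimately show ?thesis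
    using \<kappa> L unfolding has_FP_def by blast
qed

text \<open>Mean value inequality on the disc of radius \<open>norm z\<close>, where the derivative
  of \<open>exp\<close> is at most \<open>exp (norm z)\<close>.\<close>

lemma norm_exp_minus_one_le: "norm (exp z - 1) \<le> norm z * exp (norm z)" for z :: complex
proof -
  have "norm (exp z - exp 0) \<le> exp (norm z) * norm (z - 0)"
  proof (rule field_differentiable_bound[of "cball 0 (norm z)"])
    show "(exp has_field_derivative exp w) (at w within cball 0 (norm z))" for w :: complex
      by (rule has_field_derivative_at_within[OF DERIV_exp])
    show "norm (exp w) \<le> exp (norm z)" if "w \<in> cball 0 (norm z)" for w :: complex
      using that complex_Re_le_cmod[of w] by simp
  qed auto
  then show ?thesis by (simp add: mult.commute)
qed

text \<open>The inequality \<open>ln v \<le> v - 1\<close> is used for \<open>u\<close> and for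
  \<open>1 / u\<close>; the factor 2 comes from \<open>u \<ge> 1/2\<close>.\<close>

lemma abs_ln_le:
  fixes u :: real
  assumes "\<bar>u - 1\<bar> \<le> 1 / 2"
  shows "\<bar>ln u\<bar> \<le> 2 * \<bar>u - 1\<bar>"
proof -
  have u: "u \<ge> 1/2" using assms by linarith
  then have u0: "u > 0" by linarith
  have "ln u \<le> u - 1" by (rule ln_le_minus_one[OF u0])
  also have "\<dots> \<le> 2 * \<bar>u - 1\<bar>" by (cases "u \<ge> 1"; simp)
  finally have "ln u \<le> 2 * \<bar>u - 1\<bar>" .
  moreover have "- ln u \<le> 2 * \<bar>u - 1\<bar>"
  proof -
    have "- ln u = ln (1 / u)" using u0 by (simp add: ln_div)
    also have "\<dots> \<le> 1 / u - 1" using u0 by (intro ln_le_minus_one) auto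
    also have "\<dots> = (1 - u) / u" using u0 by (simp add: field_simps)
    also have "\<dots> \<le> \<bar>u - 1\<bar> / u" using u0 by (intro divide_right_mono) auto
    also have "\<dots> \<le> \<bar>u - 1\<bar> / (1/2)" using u by (intro divide_left_mono) auto
    finally show ?thesis by simp
  qed
  ultimately show ?thesis by (intro abs_leI)
qed

text \<open>Dominated convergence along sequences, with majorant \<open>\<bar>G x\<bar>\<close>. The
  null set \<open>N\<close> is meant for the centres, which the exhausting sets never
  contain.\<close>

lemma tendsto_set_integral_exhaustion:
  fixes G :: "'a::euclidean_space \<Rightarrow> real"
  assumes G: "integrable lborel G" and S: "\<And>s. S s \<in> sets borel" and N: "finite N"
    and ev: "\<And>x. x \<notin> N \<Longrightarrow> \<forall>\<^sub>F s in at_right 0. x \<in> S s"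
  shows "((\<lambda>s. LINT x:S s|lborel. G x) \<longlongrightarrow> (LINT x|lborel. G x)) (at_right (0::real))"
proof (rule tendsto_at_right_sequentially[of 0 1])
  fix X :: "nat \<Rightarrow> real" assume X: "\<And>n. 0 < X n" and lim: "X \<longlonglongrightarrow> 0"
  have fl: "filterlim X (at_right 0) sequentially"
    using X lim unfolding filterlim_at by (auto intro!: always_eventually simp: less_imp_neq[THEN not_sym])
  note S[measurable] G[measurable]
  show "(\<lambda>n. LINT x:S (X n)|lborel. G x) \<longlonglongrightarrow> (LINT x|lborel. G x)"
    unfolding set_lebesgue_integral_def
  proof (rule integral_dominated_convergence)
    show "integrable lborel (\<lambda>x. \<bar>G x\<bar>)" using G by simp
    have "N \<in> null_sets lborel" using N by (rule finite_imp_null_set_lborel)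
    then have "AE x in lborel. x \<notin> N" by (rule AE_not_in)
    then show "AE x in lborel. (\<lambda>n. indicator (S (X n)) x *\<^sub>R G x) \<longlonglongrightarrow> G x"
    proof eventually_elim
      case (elim x)
      show ?case
        by (rule tendsto_eventually)
           (use filterlim_iff[THEN iffD1, OF fl, rule_format, OF ev[OF elim]] in eventually_elim, simp)
    qed
    show "AE x in lborel. norm (indicator (S (X n)) x *\<^sub>R G x) \<le> \<bar>G x\<bar>" for n
      by (rule AE_I2) (auto simp: indicator_def)
  qed measurable
qed simp

lemma continuous_on_sphere_bounded:
  assumes "continuous_on (sphere 0 1) (f :: real^3 \<Rightarrow> real)"
  obtains M where "M \<ge> 0" "\<And>x. x \<noteq> y \<Longrightarrow> \<bar>f (sgn (x - y))\<bar> \<le> M"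
proof -
  have "bounded (f ` sphere 0 1)"
    by (rule compact_imp_bounded[OF compact_continuous_image[OF assms compact_sphere]])
  then obtain M where M: "\<forall>z\<in>f ` sphere 0 1. norm z \<le> M" unfolding bounded_iff by blast
  then have "\<bar>f (sgn (x - y))\<bar> \<le> \<bar>M\<bar>" if "x \<noteq> y" for x
  proof -
    have "sgn (x - y) \<in> sphere 0 1" using that by (simp add: norm_sgn)
    then have "\<bar>f (sgn (x - y))\<bar> \<le> M" using M by simp
    then show ?thesis by linarith
  qed
  then show ?thesis by (intro that[of "\<bar>M\<bar>"]) auto
qed

lemma integrable_tail_powr:
  fixes y :: "real^3"
  assumes "R > 0" "e < -3"
  shows "integrable lborel (\<lambda>x. indicator {R<..} (norm (x - y)) * norm (x - y) powr e)"
  using integrable_powr_angular[of "\<lambda>_. 1", OF _ _ _ has_integral_Ioi_powr[OF assms(1)], of e y] assms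
  by simp

subsection \<open>Two singular centres\<close>

text \<open>The radius \<open>\<rho>\<close> makes the two closed balls disjoint and keeps the
  remainders of order zero bounded on both; the singular parts are cut off there.\<close>

locale two_centres =
  fixes y1 y2 :: "real^3" and F :: "real^3 \<Rightarrow> real" and A1 A2 :: "real set"
    and f1 f2 :: "real \<Rightarrow> real^3 \<Rightarrow> real" and \<epsilon> \<rho> :: real
  assumes exp1: "has_radial_expansion F y1 A1 f1" and exp2: "has_radial_expansion F y2 A2 f2"
    and contF: "continuous_on (- {y1, y2}) F"
    and \<epsilon>: "\<epsilon> > 0" and decay: "F \<in> O[at_infinity](\<lambda>x. norm x powr (- 3 - \<epsilon>))"
    and \<rho>: "\<rho> > 0" "2 * \<rho> < norm (y1 - y2)"
    and near1: "\<And>x. 0 < norm (x - y1) \<Longrightarrow> norm (x - y1) \<le> \<rho> \<Longrightarrow>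
       \<bar>F x - (\<Sum>a\<in>{a\<in>A1. a \<le> 0}. norm (x - y1) powr a * f1 a (sgn (x - y1)))\<bar> \<le> 1"
    and near2: "\<And>x. 0 < norm (x - y2) \<Longrightarrow> norm (x - y2) \<le> \<rho> \<Longrightarrow>
       \<bar>F x - (\<Sum>a\<in>{a\<in>A2. a \<le> 0}. norm (x - y2) powr a * f2 a (sgn (x - y2)))\<bar> \<le> 1"
begin

abbreviation "r1 x \<equiv> norm (x - y1)"
abbreviation "r2 x \<equiv> norm (x - y2)"
abbreviation "d \<equiv> norm (y1 - y2)"
abbreviation "sing1 \<equiv> singular_part y1 A1 f1"
abbreviation "sing2 \<equiv> singular_part y2 A2 f2"

lemma r_triangle: "r1 x \<le> r2 x + d" "r2 x \<le> r1 x + d" "d \<le> r1 x + r2 x"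
proof -
  show "r1 x \<le> r2 x + d"
    using norm_triangle_ineq[of "x - y2" "y2 - y1"] by (simp add: norm_minus_commute)
  show "r2 x \<le> r1 x + d"
    using norm_triangle_ineq[of "x - y1" "y1 - y2"] by simp
  show "d \<le> r1 x + r2 x"
    using norm_triangle_ineq[of "y1 - x" "x - y2"] by (simp add: norm_minus_commute)
qed

lemma cont1: "continuous_on (sphere 0 1) (f1 a)"
  by (rule has_radial_expansion_continuous[OF exp1 \<rho>(1)], rule continuous_on_subset[OF contF])
     (use \<rho> in \<open>auto simp: dist_norm\<close>)

lemma cont2: "continuous_on (sphere 0 1) (f2 a)"
  by (rule has_radial_expansion_continuous[OF exp2 \<rho>(1)], rule continuous_on_subset[OF contF])
     (use \<rho> in \<open>auto simp: dist_norm norm_minus_commute\<close>)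

lemma F_measurable [measurable]: "F \<in> borel_measurable borel"
  by (rule borel_measurable_continuous_countable_exceptions[OF _ contF]) simp

lemma sing_measurable [measurable]: "sing1 \<in> borel_measurable borel" "sing2 \<in> borel_measurable borel"
  "log_part y2 f2 \<in> borel_measurable borel" "power_part y2 A2 f2 \<in> borel_measurable borel"
  unfolding singular_part_def[abs_def] log_part_def[abs_def] power_part_def[abs_def]
  by (intro borel_measurable_sum borel_measurable_powr_angular cont1 cont2)+

text \<open>Near infinity the decay hypothesis applies; the rest of the region is compact, and there
  the continuous \<open>F x * r2 x powr (3 + \<epsilon>)\<close> is bounded. The bound is in
  \<open>r2\<close> because tails are integrated around \<open>y2\<close>.\<close>

lemma far_bound:
  assumes s: "s > 0"
  obtains C where "C \<ge> 0" "\<And>x. s \<le> r1 x \<Longrightarrow> s \<le> r2 x \<Longrightarrow> \<bar>F x\<bar> \<le> C * r2 x powr (- 3 - \<epsilon>)"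
proof -
  obtain c where c: "c > 0" "\<forall>\<^sub>F x in at_infinity. norm (F x) \<le> c * norm (norm x powr (- 3 - \<epsilon>))"
    using landau_o.bigE[OF decay] by blast
  then obtain T where T: "\<And>x. T \<le> norm x \<Longrightarrow> \<bar>F x\<bar> \<le> c * norm x powr (- 3 - \<epsilon>)"
    unfolding eventually_at_infinity by auto
  \<comment> \<open>Beyond \<open>T'\<close> also \<open>r2 x \<le> 2 * norm x\<close>, which costs
    the factor \<open>2 powr (3 + \<epsilon>)\<close> in \<open>C\<close>.\<close>
  define T' where "T' = max T (norm y2 + 1)"
  define S where "S = cball 0 T' \<inter> {x. s \<le> r1 x} \<inter> {x. s \<le> r2 x}"
  have "compact S"
    unfolding S_def by (intro compact_Int_closed compact_cball closed_Collect_le continuous_intros)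
  moreover have "continuous_on S (\<lambda>x. F x * r2 x powr (3 + \<epsilon>))"
  proof (intro continuous_intros)
    show "continuous_on S F"
      by (rule continuous_on_subset[OF contF]) (use s in \<open>auto simp: S_def\<close>)
  qed (use s in \<open>auto simp: S_def\<close>)
  ultimately have "bounded ((\<lambda>x. F x * r2 x powr (3 + \<epsilon>)) ` S)"
    by (intro compact_imp_bounded compact_continuous_image)
  then obtain M where M: "\<And>x. x \<in> S \<Longrightarrow> \<bar>F x * r2 x powr (3 + \<epsilon>)\<bar> \<le> M"
    unfolding bounded_iff by auto
  define C where "C = max \<bar>M\<bar> (c * 2 powr (3 + \<epsilon>))"
  show ?thesis
  proof
    show "C \<ge> 0" unfolding C_def by auto
    fix x assume x: "s \<le> r1 x" "s \<le> r2 x"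
    have r2: "r2 x > 0" using s x by linarith
    have inv: "r2 x powr (- 3 - \<epsilon>) = 1 / r2 x powr (3 + \<epsilon>)"
      by (simp add: powr_minus_divide[of _ "3 + \<epsilon>", simplified])
    show "\<bar>F x\<bar> \<le> C * r2 x powr (- 3 - \<epsilon>)"
    proof (cases "norm x \<le> T'")
      case True
      then have "\<bar>F x * r2 x powr (3 + \<epsilon>)\<bar> \<le> C"
        using M[of x] x unfolding S_def C_def by auto
      then show ?thesis using r2 unfolding inv by (simp add: abs_mult pos_le_divide_eq)
    next
      case False
      then have nx: "norm x > T" "norm x > norm y2 + 1" unfolding T'_def by auto
      have "r2 x \<le> 2 * norm x" using norm_triangle_ineq4[of x y2] nx by linarith
      then have "norm x powr (- 3 - \<epsilon>) \<le> (r2 x / 2) powr (- 3 - \<epsilon>)"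
        using r2 \<epsilon> by (intro powr_mono2') auto
      also have "\<dots> = 2 powr (3 + \<epsilon>) * r2 x powr (- 3 - \<epsilon>)"
        unfolding inv using r2 by (simp add: powr_divide powr_minus_divide[of _ "3 + \<epsilon>", simplified])
      finally have "c * norm x powr (- 3 - \<epsilon>) \<le> c * (2 powr (3 + \<epsilon>) * r2 x powr (- 3 - \<epsilon>))"
        by (rule mult_left_mono) (use c(1) in simp)
      then have "\<bar>F x\<bar> \<le> c * (2 powr (3 + \<epsilon>) * r2 x powr (- 3 - \<epsilon>))"
        using T[of x] nx by linarith
      also have "\<dots> \<le> C * r2 x powr (- 3 - \<epsilon>)"
        unfolding mult.assoc[symmetric] by (intro mult_right_mono) (auto simp: C_def)
      finally show ?thesis .
    qed
  qed
qed

section \<open>The partie finie of \<open>F\<close>\<close>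

definition G :: "real^3 \<Rightarrow> real" where
  "G x = F x - indicator {..\<rho>} (r1 x) * sing1 x - indicator {..\<rho>} (r2 x) * sing2 x"

text \<open>The disjoint balls divide space into three regions: the decay bound serves outside both,
  and in each ball only its own singular part is active.\<close>

lemma integrable_G: "integrable lborel G"
proof -
  obtain C where C: "C \<ge> 0" "\<And>x. \<rho> \<le> r1 x \<Longrightarrow> \<rho> \<le> r2 x \<Longrightarrow> \<bar>F x\<bar> \<le> C * r2 x powr (- 3 - \<epsilon>)"
    using far_bound[OF \<rho>(1)] by blast
  have "integrable lborel (\<lambda>x. indicator {\<rho><..} (r1 x) * indicator {\<rho><..} (r2 x) * F x)"
  proof (rule Bochner_Integration.integrable_bound)
    show "integrable lborel (\<lambda>x. C * (indicator {\<rho><..} (r2 x) * r2 x powr (- 3 - \<epsilon>)))"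
      by (intro integrable_mult_right integrable_tail_powr \<rho>) (use \<epsilon> in auto)
    show "AE x in lborel. norm (indicator {\<rho><..} (r1 x) * indicator {\<rho><..} (r2 x) * F x)
      \<le> norm (C * (indicator {\<rho><..} (r2 x) * r2 x powr (- 3 - \<epsilon>)))"
      using C by (intro AE_I2) (auto simp: indicator_def abs_mult)
  qed measurable
  moreover have "G x = indicator {\<rho><..} (r1 x) * indicator {\<rho><..} (r2 x) * F x
     + indicator {..\<rho>} (r1 x) * (F x - sing1 x) + indicator {..\<rho>} (r2 x) * (F x - sing2 x)" for x
    using r_triangle(3)[of x] \<rho> by (auto simp: G_def indicator_def)
  ultimately show ?thesis
    unfolding G_def[abs_def, symmetric]
    using integrable_near_subtract_singular[OF exp1 cont1 F_measurable near1 \<rho>(1)]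
      integrable_near_subtract_singular[OF exp2 cont2 F_measurable near2 \<rho>(1)]
    by (simp cong: Bochner_Integration.integrable_cong)
qed

definition regular_value :: "real \<Rightarrow> real \<Rightarrow> real" where
  "regular_value s1 s2 = (LINT x|lborel. G x) + Pf_counterterm A1 f1 s1 \<rho> + Pf_counterterm A2 f2 s2 \<rho>"

text \<open>For \<open>s \<le> \<rho>\<close> the shell integrals cancel the counterterms at
  \<open>s\<close> and leave those at \<open>\<rho>\<close>; then \<open>s\<close> enters only
  through the domain on which \<open>G\<close> is integrated.\<close>

lemma has_Pf:
  assumes s1: "s1 > 0" and s2: "s2 > 0"
  shows "has_Pf y1 y2 A1 f1 A2 f2 s1 s2 F (regular_value s1 s2)"
proof -
  let ?O = "\<lambda>s. - (cball y1 s \<union> cball y2 s)"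
  let ?sh1 = "\<lambda>s x. indicator {s<..\<rho>} (r1 x) * sing1 x"
  let ?sh2 = "\<lambda>s x. indicator {s<..\<rho>} (r2 x) * sing2 x"
  have O: "x \<in> ?O s \<longleftrightarrow> s < r1 x \<and> s < r2 x" for x s
    by (auto simp: dist_norm norm_minus_commute)
  have meas [measurable]: "?O s \<in> sets borel" for s by (intro borel_comp sets.Un) auto
  \<comment> \<open>Since \<open>2 * \<rho> < d\<close>, the shell around one centre does not meet
    the ball removed at the other, so both shells appear whole.\<close>
  have eq: "indicator (?O s) x *\<^sub>R F x = indicator (?O s) x *\<^sub>R G x + ?sh1 s x + ?sh2 s x" if s: "0 < s" "s \<le> \<rho>" for s x
  proof -
    have "indicator (?O s) x = (if s < r1 x \<and> s < r2 x then 1 else 0 :: real)"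
      using O[of x s] by (simp only: indicator_def of_bool_def)
    then show ?thesis
      using r_triangle(3)[of x] \<rho> s by (auto simp: G_def indicator_def)
  qed
  have iG: "integrable lborel (\<lambda>x. indicator (?O s) x *\<^sub>R G x)" for s
    using integrable_G integrable_mult_indicator[of "?O s" lborel G] by simp
  note i1 = integrable_singular_part_shell[OF exp1 cont1 _ _ s1]
    and i2 = integrable_singular_part_shell[OF exp2 cont2 _ _ s2]
    and v1 = integral_singular_part_shell[OF exp1 cont1 _ _ s1]
    and v2 = integral_singular_part_shell[OF exp2 cont2 _ _ s2]
  have iF: "set_integrable lborel (?O s) F" if s: "0 < s" "s \<le> \<rho>" for s
    unfolding set_integrable_def eq[OF s]
    by (intro Bochner_Integration.integrable_add iG i1 i2 s)
  \<comment> \<open>For \<open>s > \<rho>\<close> the domain is contained in the one for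
    \<open>\<rho>\<close>.\<close>
  have "set_integrable lborel (?O s) F" if s: "s > 0" for s
    by (rule set_integrable_subset[OF iF[of "min s \<rho>"]]) (use s \<rho> in auto)
  moreover have val: "(LINT x:?O s|lborel. F x) + Pf_counterterm A1 f1 s1 s + Pf_counterterm A2 f2 s2 s
      = (LINT x:?O s|lborel. G x) + Pf_counterterm A1 f1 s1 \<rho> + Pf_counterterm A2 f2 s2 \<rho>"
    if s: "0 < s" "s \<le> \<rho>" for s
  proof -
    have "(LINT x:?O s|lborel. F x) = (LINT x:?O s|lborel. G x) + (LINT x|lborel. ?sh1 s x) + (LINT x|lborel. ?sh2 s x)"
      unfolding set_lebesgue_integral_def eq[OF s]
      by (subst Bochner_Integration.integral_add Bochner_Integration.integrable_add,
          intro Bochner_Integration.integrable_add iG i1 i2 s, rule i2[OF s],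
          subst Bochner_Integration.integral_add, rule iG, rule i1[OF s], rule refl)
    then show ?thesis by (simp add: v1[OF s] v2[OF s])
  qed
  have "((\<lambda>s. (LINT x:?O s|lborel. G x) + Pf_counterterm A1 f1 s1 \<rho> + Pf_counterterm A2 f2 s2 \<rho>)
      \<longlongrightarrow> regular_value s1 s2) (at_right 0)"
    unfolding regular_value_def
  proof (intro tendsto_intros tendsto_set_integral_exhaustion[OF integrable_G, of _ "{y1, y2}"])
    fix x assume x: "x \<notin> {y1, y2}"
    then show "\<forall>\<^sub>F s in at_right 0. x \<in> ?O s"
      unfolding O by (intro eventually_at_rightI[of 0 "min (r1 x) (r2 x)"]) auto
  qed (use meas in auto)
  then have "((\<lambda>s. (LINT x:?O s|lborel. F x) + Pf_counterterm A1 f1 s1 s + Pf_counterterm A2 f2 s2 s)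
      \<longlongrightarrow> regular_value s1 s2) (at_right 0)"
    by (rule Lim_transform_eventually, intro eventually_at_rightI[of 0 \<rho>] val[symmetric])
       (use \<rho> in auto)
  ultimately show ?thesis unfolding has_Pf_def by blast
qed

section \<open>The subtracted integrand and its decay\<close>

text \<open>Beyond \<open>R\<close> the term of exponent \<open>-3\<close> is put back, so that
  \<open>K\<close> becomes integrable at infinity; the tail of that term is treated by the explicit
  integral with the pole.\<close>

definition K :: "real \<Rightarrow> real^3 \<Rightarrow> real" where
  "K R x = subtract_singular y2 A2 f2 F x + indicator {R<..} (r2 x) * log_part y2 f2 x"

lemma K_measurable [measurable]: "K R \<in> borel_measurable borel"
  unfolding K_def[abs_def] subtract_singular_eq[abs_def] by measurable

lemma K_eq:
  assumes "\<rho> \<le> R"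
  shows "K R x = G x + indicator {..\<rho>} (r1 x) * sing1 x - outer_part \<rho> R y2 A2 f2 x"
  using assms
  by (auto simp: K_def subtract_singular_eq G_def outer_part_def singular_part_split[OF exp2] indicator_def)

lemma integrable_outside_mult:
  assumes "integrable lborel (H :: real^3 \<Rightarrow> real)"
  shows "integrable lborel (\<lambda>x. indicator {s<..} (norm (x - y)) * H x)"
proof (rule Bochner_Integration.integrable_bound[OF assms])
  note borel_measurable_integrable[OF assms, measurable]
  show "(\<lambda>x. indicator {s<..} (norm (x - y)) * H x) \<in> borel_measurable lborel" by measurable
qed (auto simp: indicator_def)

lemma integrable_shell1:
  assumes s: "s > 0"
  shows "integrable lborel (\<lambda>x. indicator {s<..} (r1 x) * (indicator {..\<rho>} (r1 x) * sing1 x))"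
proof -
  have eq: "indicator {s<..} (r1 x) * (indicator {..\<rho>} (r1 x) * sing1 x) = indicator {s<..\<rho>} (r1 x) * sing1 x" for x
    by (auto simp: indicator_def)
  show ?thesis
  proof (cases "s \<le> \<rho>")
    case True
    then show ?thesis
      unfolding eq by (rule integrable_singular_part_shell[OF exp1 cont1 s _ zero_less_one])
  qed (simp add: eq)
qed

lemma integrable_K:
  assumes s: "s > 0" and R: "\<rho> \<le> R"
  shows "integrable lborel (\<lambda>x. indicator {s<..} (r1 x) * K R x)"
proof -
  have "integrable lborel (\<lambda>x. indicator {s<..} (r1 x) * (G x - outer_part \<rho> R y2 A2 f2 x)
     + indicator {s<..} (r1 x) * (indicator {..\<rho>} (r1 x) * sing1 x))"
    by (intro Bochner_Integration.integrable_add integrable_outside_mult Bochner_Integration.integrable_diff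
        integrable_G integrable_outer_part cont2 \<rho> R integrable_shell1 s)
  then show ?thesis by (simp add: K_eq[OF R] algebra_simps)
qed

text \<open>Only finitely many exponents lie below \<open>-3\<close>, so they keep a positive
  distance from it. The bound \<open>\<epsilon>\<close> reflects the decay of \<open>F\<close>, and
  \<open>1\<close> the power of \<open>r2\<close> gained by the difference of weights.\<close>

lemma power_gap:
  obtains \<kappa> where "\<kappa> > 0" "\<kappa> \<le> \<epsilon>" "\<kappa> \<le> 1" "\<And>b. b \<in> A2 \<Longrightarrow> b + 3 < 0 \<Longrightarrow> b \<le> - 3 - \<kappa>"
proof -
  let ?S = "insert \<epsilon> (insert 1 ((\<lambda>b. - 3 - b) ` {b\<in>A2. b + 3 < 0}))"
  have fin: "finite ?S" using finite_exponents(2)[OF exp2] by simp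
  show ?thesis
  proof
    show "Min ?S > 0" using fin \<epsilon> by (subst Min_gr_iff) auto
    show "Min ?S \<le> \<epsilon>" "Min ?S \<le> 1" by (rule Min_le[OF fin], simp)+
    show "b \<le> - 3 - Min ?S" if "b \<in> A2" "b + 3 < 0" for b
      using Min_le[OF fin, of "- 3 - b"] that by auto
  qed
qed

lemma power_part_far:
  assumes \<kappa>: "\<And>b. b \<in> A2 \<Longrightarrow> b + 3 < 0 \<Longrightarrow> b \<le> - 3 - \<kappa>"
  obtains C where "C \<ge> 0" "\<And>x. 1 \<le> r2 x \<Longrightarrow> \<bar>power_part y2 A2 f2 x\<bar> \<le> C * r2 x powr (- 3 - \<kappa>)"
proof -
  have "\<exists>M\<ge>0. \<forall>x. x \<noteq> y2 \<longrightarrow> \<bar>f2 b (sgn (x - y2))\<bar> \<le> M" for b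
    using continuous_on_sphere_bounded[OF cont2] by metis
  then obtain M where M: "\<And>b. M b \<ge> 0" "\<And>b x. x \<noteq> y2 \<Longrightarrow> \<bar>f2 b (sgn (x - y2))\<bar> \<le> M b"
    by metis
  show ?thesis
  proof
    show "(\<Sum>b\<in>{b\<in>A2. b + 3 < 0}. M b) \<ge> 0" using M by (simp add: sum_nonneg)
    fix x assume x: "1 \<le> r2 x"
    then have "x \<noteq> y2" by auto
    have "\<bar>power_part y2 A2 f2 x\<bar> \<le> (\<Sum>b\<in>{b\<in>A2. b + 3 < 0}. \<bar>r2 x powr b * f2 b (sgn (x - y2))\<bar>)"
      unfolding power_part_def by (rule sum_abs)
    also have "\<dots> \<le> (\<Sum>b\<in>{b\<in>A2. b + 3 < 0}. r2 x powr (- 3 - \<kappa>) * M b)"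
      unfolding abs_mult
      by (intro sum_mono mult_mono) (use x \<kappa> M(2)[OF \<open>x \<noteq> y2\<close>] in \<open>auto intro: powr_mono\<close>)
    also have "\<dots> = (\<Sum>b\<in>{b\<in>A2. b + 3 < 0}. M b) * r2 x powr (- 3 - \<kappa>)"
      unfolding sum_distrib_right by (simp add: mult.commute)
    finally show "\<bar>power_part y2 A2 f2 x\<bar> \<le> (\<Sum>b\<in>{b\<in>A2. b + 3 < 0}. M b) * r2 x powr (- 3 - \<kappa>)" .
  qed
qed

text \<open>Beyond \<open>R\<close> the restored \<open>log_part\<close> cancels the term of
  exponent \<open>-3\<close>, leaving \<open>F\<close> and \<open>power_part\<close>;
  \<open>R \<ge> 1\<close> lets the larger exponent dominate.\<close>

lemma K_far:
  assumes \<kappa>: "\<kappa> \<le> \<epsilon>" "\<And>b. b \<in> A2 \<Longrightarrow> b + 3 < 0 \<Longrightarrow> b \<le> - 3 - \<kappa>" and s: "s > 0" and R: "R \<ge> 1"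
  obtains C where "C \<ge> 0" "\<And>x. s < r1 x \<Longrightarrow> R < r2 x \<Longrightarrow> \<bar>K R x\<bar> \<le> C * r2 x powr (- 3 - \<kappa>)"
proof -
  \<comment> \<open>\<open>min s 1\<close> lies below both \<open>s\<close> and \<open>R\<close>,
    the lower bounds for \<open>r1\<close> and \<open>r2\<close>.\<close>
  obtain C1 where C1: "C1 \<ge> 0" "\<And>x. min s 1 \<le> r1 x \<Longrightarrow> min s 1 \<le> r2 x \<Longrightarrow> \<bar>F x\<bar> \<le> C1 * r2 x powr (- 3 - \<epsilon>)"
    using far_bound[of "min s 1"] s by auto
  obtain C2 where C2: "C2 \<ge> 0" "\<And>x. 1 \<le> r2 x \<Longrightarrow> \<bar>power_part y2 A2 f2 x\<bar> \<le> C2 * r2 x powr (- 3 - \<kappa>)"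
    using power_part_far[OF \<kappa>(2)] by blast
  show ?thesis
  proof
    show "C1 + C2 \<ge> 0" using C1 C2 by simp
    fix x assume x: "s < r1 x" "R < r2 x"
    have "K R x = F x - power_part y2 A2 f2 x"
      using x by (simp add: K_def subtract_singular_eq singular_part_split[OF exp2])
    then have "\<bar>K R x\<bar> \<le> \<bar>F x\<bar> + \<bar>power_part y2 A2 f2 x\<bar>" by linarith
    also have "\<bar>F x\<bar> \<le> C1 * r2 x powr (- 3 - \<epsilon>)" using C1 x R by auto
    also have "C1 * r2 x powr (- 3 - \<epsilon>) \<le> C1 * r2 x powr (- 3 - \<kappa>)"
      using x R \<kappa>(1) C1(1) by (intro mult_left_mono powr_mono) auto
    also have "\<bar>power_part y2 A2 f2 x\<bar> \<le> C2 * r2 x powr (- 3 - \<kappa>)" using C2 x R by auto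
    finally show "\<bar>K R x\<bar> \<le> (C1 + C2) * r2 x powr (- 3 - \<kappa>)" by (simp add: distrib_right)
  qed
qed

(* The integrand minus (r2/\<sigma>)^B log_part on r2 > R, arranged so that it stays integrable for B in a
   neighbourhood of 0. *)
definition kernel :: "real \<Rightarrow> real \<Rightarrow> real \<Rightarrow> complex \<Rightarrow> real^3 \<Rightarrow> complex" where
  "kernel \<sigma> s R B x =
     exp (B * of_real (ln (r1 x / \<sigma>))) * of_real (indicator {s<..} (r1 x) * K R x)
     - (exp (B * of_real (ln (r1 x / \<sigma>))) - exp (B * of_real (ln (r2 x / \<sigma>))))
         * of_real (indicator {R<..} (r2 x) * log_part y2 f2 x)"

lemma kernel_measurable [measurable]: "kernel \<sigma> s R B \<in> borel_measurable borel"
  unfolding kernel_def[abs_def] by measurable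

section \<open>Bounds on the weights, uniform in \<open>B\<close>\<close>

text \<open>Here \<open>r1 x\<close> stays between \<open>s\<close> and \<open>R + d\<close>, so its
  logarithm is bounded and the estimate holds for either sign of \<open>Re B\<close>.\<close>

lemma weight_near:
  assumes c: "0 < s" "s < r1 x" "r2 x \<le> R" and \<sigma>: "\<sigma> > 0" and B: "norm (B :: complex) \<le> M"
  shows "norm (exp (B * of_real (ln (r1 x / \<sigma>)))) \<le> exp (M * (\<bar>ln (s / \<sigma>)\<bar> + \<bar>ln ((R + d) / \<sigma>)\<bar>))"
proof -
  have r1: "r1 x > 0" "r1 x \<le> R + d" using c r_triangle(1)[of x] by linarith+
  have "ln (s / \<sigma>) \<le> ln (r1 x / \<sigma>)" "ln (r1 x / \<sigma>) \<le> ln ((R + d) / \<sigma>)"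
    using c r1 \<sigma> by (auto intro!: ln_mono divide_right_mono)
  then have l: "\<bar>ln (r1 x / \<sigma>)\<bar> \<le> \<bar>ln (s / \<sigma>)\<bar> + \<bar>ln ((R + d) / \<sigma>)\<bar>" by linarith
  have "Re (B * of_real (ln (r1 x / \<sigma>))) \<le> norm (B * complex_of_real (ln (r1 x / \<sigma>)))"
    by (rule complex_Re_le_cmod)
  also have "\<dots> = norm B * \<bar>ln (r1 x / \<sigma>)\<bar>" by (simp add: norm_mult)
  also have "\<dots> \<le> M * (\<bar>ln (s / \<sigma>)\<bar> + \<bar>ln ((R + d) / \<sigma>)\<bar>)"
    using B l order_trans[OF norm_ge_zero B] by (intro mult_mono) auto
  finally show ?thesis by (simp only: norm_exp_eq_Re exp_le_cancel_iff)
qed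

lemma norm_exp_ln:
  assumes "c > 0"
  shows "norm (exp (B * complex_of_real (ln c))) = c powr Re B"
  using assms by (simp add: powr_def)

text \<open>With this \<open>R\<close> both distances exceed \<open>\<sigma>\<close>, so the weights
  grow with \<open>Re B\<close>, and \<open>r1 / r2\<close> is within \<open>1/2\<close> of
  \<open>1\<close>, the range of \<open>abs_ln_le\<close>.\<close>

lemma weights_far:
  assumes R: "2 * d + 2 * \<sigma> \<le> R" and x: "R < r2 x" and \<sigma>: "\<sigma> > 0"
  shows "r1 x / \<sigma> \<ge> 1" "r1 x / \<sigma> \<le> 2 * r2 x / \<sigma>" "r2 x / \<sigma> \<ge> 1" "\<bar>ln (r1 x / r2 x)\<bar> \<le> 2 * d / r2 x" "2 * d / r2 x \<le> 1"
proof -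
  have d0: "d \<ge> 0" by simp
  have r: "r2 x > 0" "r1 x \<le> 2 * r2 x" "r2 x \<le> 2 * r1 x" "\<sigma> \<le> r1 x" "\<sigma> \<le> r2 x"
    using r_triangle(1,2)[of x] x R \<sigma> d0 by linarith+
  then show "r1 x / \<sigma> \<ge> 1" "r2 x / \<sigma> \<ge> 1" "r1 x / \<sigma> \<le> 2 * r2 x / \<sigma>"
    using \<sigma> by (auto simp: divide_right_mono)
  show d2: "2 * d / r2 x \<le> 1" using r x R \<sigma> by simp
  have "\<bar>r1 x - r2 x\<bar> \<le> d" using r_triangle(1,2)[of x] by linarith
  moreover have "r1 x / r2 x - 1 = (r1 x - r2 x) / r2 x" using r by (simp add: field_simps)
  ultimately have u: "\<bar>r1 x / r2 x - 1\<bar> \<le> d / r2 x" using r by (simp add: divide_right_mono)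
  also have "\<dots> \<le> 1 / 2"
  proof -
    have "2 * (d / r2 x) \<le> 1" using d2 by simp
    then show ?thesis by linarith
  qed
  finally have "\<bar>ln (r1 x / r2 x)\<bar> \<le> 2 * \<bar>r1 x / r2 x - 1\<bar>" by (rule abs_ln_le)
  also have "\<dots> \<le> 2 * d / r2 x" using u by simp
  finally show "\<bar>ln (r1 x / r2 x)\<bar> \<le> 2 * d / r2 x" .
qed

text \<open>Factoring out the weight of \<open>r2\<close> leaves
  \<open>exp (B ln (r1 / r2)) - 1\<close>, which is of order \<open>d / r2\<close>. The gained power
  of \<open>r2\<close> makes the product with \<open>log_part\<close> integrable at infinity for
  \<open>\<theta> < 1\<close>.\<close>

lemma weight_difference_far:
  assumes R: "2 * d + 2 * \<sigma> \<le> R" and x: "R < r2 x" and \<sigma>: "\<sigma> > 0" and B: "norm B \<le> M" "Re B \<le> \<theta>"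
  shows "norm (exp (B * of_real (ln (r1 x / \<sigma>))) - exp (B * of_real (ln (r2 x / \<sigma>))))
    \<le> (r2 x / \<sigma>) powr \<theta> * (M * exp M * (2 * d / r2 x))"
proof -
  note w = weights_far[OF R x \<sigma>]
  have d0: "d \<ge> 0" by simp
  have r: "r2 x > 0" "r1 x > 0" using w(1,3) \<sigma> by (auto simp: pos_le_divide_eq)
  have M: "M \<ge> 0" using order_trans[OF norm_ge_zero B(1)] .
  let ?t = "ln (r1 x / r2 x)"
  have "ln (r1 x / \<sigma>) = ln (r2 x / \<sigma>) + ?t" using r \<sigma> by (simp add: ln_div)
  then have "exp (B * of_real (ln (r1 x / \<sigma>))) - exp (B * of_real (ln (r2 x / \<sigma>)))
     = exp (B * of_real (ln (r2 x / \<sigma>))) * (exp (B * of_real ?t) - 1)"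
    by (simp add: exp_add distrib_left right_diff_distrib)
  then have "norm (exp (B * of_real (ln (r1 x / \<sigma>))) - exp (B * of_real (ln (r2 x / \<sigma>))))
     = (r2 x / \<sigma>) powr Re B * norm (exp (B * of_real ?t) - 1)"
    using r \<sigma> by (simp only: norm_mult norm_exp_ln divide_pos_pos)
  also have "\<dots> \<le> (r2 x / \<sigma>) powr \<theta> * (M * exp M * (2 * d / r2 x))"
  proof (rule mult_mono)
    show "(r2 x / \<sigma>) powr Re B \<le> (r2 x / \<sigma>) powr \<theta>"
      using w(3) B(2) by (intro powr_mono) auto
    have t: "norm (B * complex_of_real ?t) \<le> M * (2 * d / r2 x)"
      unfolding norm_mult norm_of_real using w(4) B(1) M by (intro mult_mono) auto
    also have "\<dots> \<le> M * 1" using w(5) M by (rule mult_left_mono)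
    finally have t1: "norm (B * complex_of_real ?t) \<le> M" by simp
    have "norm (exp (B * of_real ?t) - 1) \<le> norm (B * complex_of_real ?t) * exp (norm (B * complex_of_real ?t))"
      by (rule norm_exp_minus_one_le)
    also have "\<dots> \<le> (M * (2 * d / r2 x)) * exp M"
      using t t1 M r by (intro mult_mono) auto
    finally show "norm (exp (B * of_real ?t) - 1) \<le> M * exp M * (2 * d / r2 x)" by (simp add: mult_ac)
  qed auto
  finally show ?thesis .
qed

text \<open>Up to \<open>R\<close> the weight is bounded and \<open>K\<close> is integrable off the
  ball around \<open>y1\<close>. Beyond \<open>R\<close> the two terms are of order
  \<open>r2 powr (\<theta> - 3 - \<kappa>)\<close> and \<open>r2 powr (\<theta> - 4)\<close>,
  integrable since \<open>\<theta> < \<kappa> \<le> 1\<close>.\<close>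

lemma kernel_dominated:
  assumes \<kappa>: "\<kappa> > 0" "\<kappa> \<le> \<epsilon>" "\<kappa> \<le> 1" "\<And>b. b \<in> A2 \<Longrightarrow> b + 3 < 0 \<Longrightarrow> b \<le> - 3 - \<kappa>"
    and s: "s > 0" and \<sigma>: "\<sigma> > 0"
    and R: "1 \<le> R" "\<rho> \<le> R" "2 * d + 2 * \<sigma> \<le> R" and \<theta>: "0 \<le> \<theta>" "\<theta> < \<kappa>"
  obtains g where "integrable lborel g"
    "\<And>B x. norm B \<le> M \<Longrightarrow> Re B \<le> \<theta> \<Longrightarrow> norm (kernel \<sigma> s R B x) \<le> g x"
proof -
  obtain C where C: "C \<ge> 0" "\<And>x. s < r1 x \<Longrightarrow> R < r2 x \<Longrightarrow> \<bar>K R x\<bar> \<le> C * r2 x powr (- 3 - \<kappa>)"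
    using K_far[OF \<kappa>(2,4) s R(1)] by blast
  obtain Q where Q: "Q \<ge> 0" "\<And>x. x \<noteq> y2 \<Longrightarrow> \<bar>f2 (-3) (sgn (x - y2))\<bar> \<le> Q"
    using continuous_on_sphere_bounded[OF cont2] by metis
  \<comment> \<open>\<open>W\<close> is the bound of \<open>weight_near\<close>, the 2 in
    \<open>c1\<close> comes from \<open>r1 x \<le> 2 * r2 x\<close>, and \<open>c2\<close> collects
    the constants of \<open>weight_difference_far\<close> and the angular bound
    \<open>Q\<close>.\<close>
  define W where "W = exp (M * (\<bar>ln (s / \<sigma>)\<bar> + \<bar>ln ((R + d) / \<sigma>)\<bar>))"
  define c1 where "c1 = (2 / \<sigma>) powr \<theta> * C"
  define c2 where "c2 = (1 / \<sigma>) powr \<theta> * (M * exp M * (2 * d) * Q)"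
  define g where "g x = W * \<bar>indicator {s<..} (r1 x) * K R x\<bar>
      + c1 * (indicator {R<..} (r2 x) * r2 x powr (\<theta> - 3 - \<kappa>))
      + c2 * (indicator {R<..} (r2 x) * r2 x powr (\<theta> - 4))" for x
  have W: "W \<ge> 0" and c1: "c1 \<ge> 0" using C by (auto simp: W_def c1_def)
  show ?thesis
  proof
    show "integrable lborel g"
      unfolding g_def[abs_def]
      by (intro Bochner_Integration.integrable_add integrable_mult_right integrable_abs integrable_K s R
          integrable_tail_powr) (use R \<theta> \<kappa> in auto)
    fix B x assume B: "norm B \<le> M" "Re B \<le> \<theta>"
    have M: "M \<ge> 0" using order_trans[OF norm_ge_zero B(1)] .
    have c2: "c2 \<ge> 0" using M Q by (auto simp: c2_def intro!: mult_nonneg_nonneg)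
    show "norm (kernel \<sigma> s R B x) \<le> g x"
    proof (cases "r2 x \<le> R")
      case True
      have "norm (kernel \<sigma> s R B x) = norm (exp (B * of_real (ln (r1 x / \<sigma>)))) * \<bar>indicator {s<..} (r1 x) * K R x\<bar>"
        using True by (simp add: kernel_def norm_mult abs_mult)
      also have "\<dots> \<le> W * \<bar>indicator {s<..} (r1 x) * K R x\<bar>"
      proof (cases "s < r1 x")
        case True
        then show ?thesis
          using weight_near[OF s True \<open>r2 x \<le> R\<close> \<sigma> B(1)] unfolding W_def by (intro mult_right_mono) auto
      qed simp
      also have "\<dots> \<le> g x" using True by (simp add: g_def)
      finally show ?thesis .
    next
      case False
      then have x: "R < r2 x" by simp
      note w = weights_far[OF R(3) x \<sigma>]
      have r: "r2 x > 0" "r1 x > 0" using w(1,3) \<sigma> by (auto simp: pos_le_divide_eq)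
      have "norm (exp (B * of_real (ln (r1 x / \<sigma>)))) = (r1 x / \<sigma>) powr Re B"
        using r \<sigma> by (intro norm_exp_ln divide_pos_pos)
      also have "\<dots> \<le> (r1 x / \<sigma>) powr \<theta>" using w(1) B by (intro powr_mono) auto
      also have "\<dots> \<le> (2 * r2 x / \<sigma>) powr \<theta>"
        using w(1,2) \<theta> r \<sigma> by (intro powr_mono2) auto
      also have "\<dots> = (2 / \<sigma>) powr \<theta> * r2 x powr \<theta>"
        using r \<sigma> by (simp add: powr_mult powr_divide)
      finally have e1: "norm (exp (B * of_real (ln (r1 x / \<sigma>)))) \<le> (2 / \<sigma>) powr \<theta> * r2 x powr \<theta>" .
      have e2: "\<bar>indicator {s<..} (r1 x) * K R x\<bar> \<le> C * r2 x powr (- 3 - \<kappa>)"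
        using C x by (auto simp: indicator_def)
      have "norm (exp (B * of_real (ln (r1 x / \<sigma>))) * complex_of_real (indicator {s<..} (r1 x) * K R x))
          \<le> ((2 / \<sigma>) powr \<theta> * r2 x powr \<theta>) * (C * r2 x powr (- 3 - \<kappa>))"
        unfolding norm_mult[of "exp _"] norm_of_real by (rule mult_mono[OF e1 e2]) auto
      also have "\<dots> = c1 * r2 x powr (\<theta> - 3 - \<kappa>)"
      proof -
        have "r2 x powr (\<theta> - 3 - \<kappa>) = r2 x powr \<theta> * r2 x powr (- 3 - \<kappa>)"
          by (simp add: powr_add[symmetric] algebra_simps)
        then show ?thesis by (simp add: c1_def)
      qed
      finally have t1: "norm (exp (B * of_real (ln (r1 x / \<sigma>))) * complex_of_real (indicator {s<..} (r1 x) * K R x))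
          \<le> c1 * r2 x powr (\<theta> - 3 - \<kappa>)" .
      have "x \<noteq> y2" using r by auto
      then have e3: "\<bar>log_part y2 f2 x\<bar> \<le> r2 x powr -3 * Q"
        unfolding log_part_def abs_mult by (intro mult_mono Q) auto
      have "norm ((exp (B * of_real (ln (r1 x / \<sigma>))) - exp (B * of_real (ln (r2 x / \<sigma>)))) * complex_of_real (log_part y2 f2 x))
          \<le> ((r2 x / \<sigma>) powr \<theta> * (M * exp M * (2 * d / r2 x))) * (r2 x powr -3 * Q)"
        unfolding norm_mult norm_of_real using M
        by (intro mult_mono weight_difference_far[OF R(3) x \<sigma> B] e3) (auto intro!: mult_nonneg_nonneg)
      also have "\<dots> = c2 * r2 x powr (\<theta> - 4)"
      proof -
        have "r2 x powr (\<theta> - 4) = r2 x powr \<theta> * r2 x powr - 3 * r2 x powr - 1"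
          unfolding powr_add[symmetric] by (rule arg_cong[where f = "\<lambda>e. r2 x powr e"]) simp
        moreover have "r2 x powr - 1 = 1 / r2 x" using r by (simp add: powr_minus_divide)
        ultimately have "r2 x powr (\<theta> - 4) = r2 x powr \<theta> * r2 x powr - 3 / r2 x"
          by (simp only: times_divide_eq_right mult_1_right)
        moreover have "(r2 x / \<sigma>) powr \<theta> = (1 / \<sigma>) powr \<theta> * r2 x powr \<theta>"
          using r \<sigma> by (simp add: powr_divide)
        ultimately show ?thesis by (simp add: c2_def mult_ac)
      qed
      finally have t2: "norm ((exp (B * of_real (ln (r1 x / \<sigma>))) - exp (B * of_real (ln (r2 x / \<sigma>)))) * complex_of_real (log_part y2 f2 x))
          \<le> c2 * r2 x powr (\<theta> - 4)" .
      have "norm (kernel \<sigma> s R B x) \<le> c1 * r2 x powr (\<theta> - 3 - \<kappa>) + c2 * r2 x powr (\<theta> - 4)"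
      proof -
        have "kernel \<sigma> s R B x = exp (B * of_real (ln (r1 x / \<sigma>))) * complex_of_real (indicator {s<..} (r1 x) * K R x)
          - (exp (B * of_real (ln (r1 x / \<sigma>))) - exp (B * of_real (ln (r2 x / \<sigma>)))) * complex_of_real (log_part y2 f2 x)"
          using x by (simp add: kernel_def)
        then show ?thesis
          using order_trans[OF norm_triangle_ineq4 add_mono[OF t1 t2]] by simp
      qed
      also have "\<dots> \<le> g x" using x W by (simp add: g_def)
      finally show ?thesis .
    qed
  qed
qed

section \<open>The finite parts and their limit\<close>

text \<open>Apart from the explicit tail around \<open>y2\<close>, which carries the pole, the
  integral is \<open>E B\<close>, holomorphic beyond \<open>B = 0\<close>. The tail contributes its
  residue times \<open>ln (R / \<sigma>)\<close>.\<close>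

lemma has_FP_integral_subtract_singular:
  assumes s: "s > 0" and \<sigma>: "\<sigma> > 0"
    and R: "1 \<le> R" "\<rho> \<le> R" "2 * d + 2 * \<sigma> \<le> R" "s + d \<le> R"
  shows "has_FP_integral {x. norm (x - y1) > s} y1 \<sigma> (subtract_singular y2 A2 f2 F)
    (of_real ((LINT x|lborel. indicator {s<..} (r1 x) * K R x) + solid_angle_integral (f2 (-3)) * ln (R / \<sigma>)))"
proof -
  let ?S = "{x. r1 x > s}"
  let ?I = "\<lambda>B x. complex_of_real (r1 x / \<sigma>) powr B * complex_of_real (subtract_singular y2 A2 f2 F x)"
  let ?q = "\<lambda>B x. indicator {R<..} (r2 x) *\<^sub>R
     (complex_of_real (r2 x / \<sigma>) powr B * complex_of_real (r2 x powr -3 * f2 (-3) (sgn (x - y2))))"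
  define E where "E B = (LINT x|lborel. kernel \<sigma> s R B x)" for B
  define w where "w = complex_of_real (solid_angle_integral (f2 (-3)))"
  define l where "l = complex_of_real (ln (R / \<sigma>))"
  have R0: "R > 0" using R(1) by simp
  obtain \<kappa> where \<kappa>: "\<kappa> > 0" "\<kappa> \<le> \<epsilon>" "\<kappa> \<le> 1" "\<And>b. b \<in> A2 \<Longrightarrow> b + 3 < 0 \<Longrightarrow> b \<le> - 3 - \<kappa>"
    using power_gap by blast
  note dom = kernel_dominated[OF \<kappa> s \<sigma> R(1-3)]
  have int_kernel: "integrable lborel (kernel \<sigma> s R B)" if B: "Re B < \<kappa>" for B
  proof -
    \<comment> \<open>\<open>kernel_dominated\<close> needs \<open>0 \<le> \<theta>\<close>, hence
      the maximum with \<open>0\<close>.\<close>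
    obtain g where g: "integrable lborel g"
      "\<And>B' x. norm B' \<le> norm B \<Longrightarrow> Re B' \<le> max 0 (Re B) \<Longrightarrow> norm (kernel \<sigma> s R B' x) \<le> g x"
      by (rule dom[of "max 0 (Re B)" "norm B"]) (use \<kappa>(1) B in auto)
    show ?thesis
      by (rule Bochner_Integration.integrable_bound[OF g(1)])
         (auto intro!: AE_I2 order_trans[OF g(2) abs_ge_self])
  qed
  have split: "indicator ?S x *\<^sub>R ?I B x = kernel \<sigma> s R B x - ?q B x" for B x
  proof (cases "r1 x > s")
    case True
    then have p1: "r1 x / \<sigma> > 0" using s \<sigma> by (intro divide_pos_pos) linarith+
    show ?thesis
    proof (cases "r2 x > R")
      case r2: True
      then have p2: "r2 x / \<sigma> > 0" using R0 \<sigma> by (intro divide_pos_pos) linarith+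
      show ?thesis
        using True r2 unfolding complex_powr_of_real[OF p1] complex_powr_of_real[OF p2]
        by (simp add: kernel_def K_def log_part_def algebra_simps del: of_real_mult of_real_divide)
    next
      case False
      then show ?thesis
        using True unfolding complex_powr_of_real[OF p1] by (simp add: kernel_def K_def)
    qed
  next
    case False
    \<comment> \<open>By \<open>s + d \<le> R\<close> the removed ball lies inside
      \<open>r2 x \<le> R\<close>, so the whole tail \<open>?q\<close> stays within
      \<open>?S\<close>.\<close>
    then have "r2 x \<le> R" using r_triangle(2)[of x] R(4) by linarith
    then show ?thesis using False by (simp add: kernel_def)
  qed
  note q = integrable_complex_powr_angular[OF cont2[of "-3"] R0 \<sigma>, of _ y2]
    integral_complex_powr_angular[OF cont2[of "-3"] R0 \<sigma>, of _ y2]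
  have set_int: "set_integrable lborel ?S (?I B)" if "Re B < 0" for B
    unfolding set_integrable_def split
    by (intro Bochner_Integration.integrable_diff int_kernel q(1)) (use that \<kappa> in auto)
  have val: "(LINT x:?S|lborel. ?I B x) = E B + w * exp (l * B) / B" if "Re B < 0" for B
  proof -
    have "(LINT x:?S|lborel. ?I B x) = E B - (LINT x|lborel. ?q B x)"
      unfolding set_lebesgue_integral_def split E_def
      by (rule Bochner_Integration.integral_diff) (use int_kernel q(1) that \<kappa> in auto)
    then show ?thesis
      unfolding q(2)[OF that] by (simp add: w_def l_def mult.commute)
  qed
  have hol: "E holomorphic_on {B. Re B < \<kappa>}"
    unfolding E_def
  proof (rule holomorphic_on_lebesgue_integral)
    show "(\<lambda>B. kernel \<sigma> s R B x) holomorphic_on {B. Re B < \<kappa>}" for x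
      unfolding kernel_def by (intro holomorphic_intros)
    fix B0 assume "B0 \<in> {B. Re B < \<kappa>}"
    then have B0: "Re B0 < \<kappa>" by simp
    \<comment> \<open>Half the distance to the line \<open>Re B = \<kappa>\<close> keeps the closed
      disc inside the half plane.\<close>
    define r where "r = (\<kappa> - Re B0) / 2"
    have r: "r > 0" "Re B0 + r < \<kappa>" using B0 by (auto simp: r_def field_simps)
    have ball: "norm B \<le> norm B0 + r \<and> Re B \<le> max 0 (Re B0 + r) \<and> Re B < \<kappa>" if "B \<in> cball B0 r" for B
    proof -
      have "norm (B - B0) \<le> r" using that by (simp add: dist_norm norm_minus_commute)
      moreover have "Re B - Re B0 \<le> norm (B - B0)" using complex_Re_le_cmod[of "B - B0"] by simp
      moreover have "norm B \<le> norm B0 + norm (B - B0)" using norm_triangle_ineq[of B0 "B - B0"] by simp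
      ultimately show ?thesis using r by linarith
    qed
    obtain g where g: "integrable lborel g"
      "\<And>B x. norm B \<le> norm B0 + r \<Longrightarrow> Re B \<le> max 0 (Re B0 + r) \<Longrightarrow> norm (kernel \<sigma> s R B x) \<le> g x"
      by (rule dom[of "max 0 (Re B0 + r)" "norm B0 + r"]) (use \<kappa>(1) r(2) in auto)
    show "\<exists>r>0. \<exists>g. cball B0 r \<subseteq> {B. Re B < \<kappa>} \<and> integrable lborel g \<and>
      (\<forall>B\<in>cball B0 r. \<forall>x\<in>space lborel. norm (kernel \<sigma> s R B x) \<le> g x)"
      by (rule exI[of _ r], intro conjI r exI[of _ g] g(1)) (use ball g(2) in auto)
  qed simp
  \<comment> \<open>At \<open>B = 0\<close> both weights are \<open>1\<close>, so the correction
    term in \<open>kernel\<close> drops out.\<close>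
  have E0: "E 0 = of_real (LINT x|lborel. indicator {s<..} (r1 x) * K R x)"
    unfolding E_def kernel_def by (simp del: of_real_mult)
  have "has_FP (\<lambda>B. LINT x:?S|lborel. ?I B x) (E 0 + w * l)"
    by (rule has_FP_simple_pole[OF \<kappa>(1) hol val])
  then show ?thesis
    unfolding has_FP_integral_def using set_int by (simp add: E0 w_def l_def)
qed

text \<open>By \<open>K_eq\<close> the integral of \<open>K\<close> is that of the integrable
  \<open>?H\<close> plus a shell around \<open>y1\<close>, whose dependence on \<open>s\<close> the
  counterterm cancels.\<close>

lemma tendsto_outside_integral_K:
  assumes s1: "s1 > 0" and s2: "s2 > 0" and R: "\<rho> \<le> R"
  shows "((\<lambda>s. (LINT x|lborel. indicator {s<..} (r1 x) * K R x) + solid_angle_integral (f2 (-3)) * ln (R / s2)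
      + Pf_counterterm A1 f1 s1 s) \<longlongrightarrow> regular_value s1 s2) (at_right 0)"
proof -
  let ?H = "\<lambda>x. G x - outer_part \<rho> R y2 A2 f2 x"
  have H: "integrable lborel ?H"
    by (intro Bochner_Integration.integrable_diff integrable_G integrable_outer_part cont2 \<rho> R)
  have R0: "R > 0" using \<rho> R by linarith
  \<comment> \<open>Since \<open>ln (\<rho> / R) + ln (R / s2) = ln (\<rho> / s2)\<close>, the
    auxiliary \<open>R\<close> disappears and \<open>s2\<close> takes its place as the
    scale.\<close>
  have "Pf_counterterm A2 f2 R \<rho> + solid_angle_integral (f2 (-3)) * ln (R / s2) = Pf_counterterm A2 f2 s2 \<rho>"
    using R0 s2 \<rho> by (simp add: Pf_counterterm_def ln_div algebra_simps)
  then have reg: "regular_value s1 s2 = (LINT x|lborel. ?H x) + Pf_counterterm A1 f1 s1 \<rho>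
      + solid_angle_integral (f2 (-3)) * ln (R / s2)"
    unfolding regular_value_def
    by (simp add: Bochner_Integration.integral_diff integrable_G integrable_outer_part cont2 \<rho> R integral_outer_part)
  have val: "(LINT x|lborel. indicator {s<..} (r1 x) * K R x)
     = (LINT x:{x. s < r1 x}|lborel. ?H x) + (Pf_counterterm A1 f1 s1 \<rho> - Pf_counterterm A1 f1 s1 s)"
    if s: "0 < s" "s \<le> \<rho>" for s
  proof -
    have "indicator {s<..} (r1 x) * K R x = indicator {x. s < r1 x} x *\<^sub>R ?H x + indicator {s<..\<rho>} (r1 x) * sing1 x" for x
      by (auto simp: K_eq[OF R] indicator_def)
    moreover have "integrable lborel (\<lambda>x. indicator {x. s < r1 x} x *\<^sub>R ?H x)"
    proof -
      have "indicator {x. s < r1 x} x *\<^sub>R ?H x = indicator {s<..} (r1 x) * ?H x" for x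
        by (simp add: indicator_def)
      then show ?thesis using integrable_outside_mult[OF H, of s y1] by (simp only:)
    qed
    ultimately show ?thesis
      using integrable_singular_part_shell[OF exp1 cont1 s s1]
      by (simp add: set_lebesgue_integral_def integral_singular_part_shell[OF exp1 cont1 s s1])
  qed
  have "((\<lambda>s. (LINT x:{x. s < r1 x}|lborel. ?H x) + Pf_counterterm A1 f1 s1 \<rho>
      + solid_angle_integral (f2 (-3)) * ln (R / s2)) \<longlongrightarrow> regular_value s1 s2) (at_right 0)"
    unfolding reg
  proof (intro tendsto_intros tendsto_set_integral_exhaustion[OF H, of _ "{y1}"])
    fix x assume "x \<notin> {y1}"
    then show "\<forall>\<^sub>F s in at_right 0. x \<in> {x. s < r1 x}"
      by (intro eventually_at_rightI[of 0 "r1 x"]) auto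
  qed auto
  then show ?thesis
    by (rule Lim_transform_eventually, intro eventually_at_rightI[of 0 \<rho>])
       (use \<rho> in \<open>auto simp: val\<close>)
qed

lemma has_Pf_FP:
  assumes s1: "s1 > 0" and s2: "s2 > 0"
  shows "has_Pf_FP y1 A1 f1 s1 s2 (subtract_singular y2 A2 f2 F) (of_real (regular_value s1 s2))"
proof -
  define R0 where "R0 = 1 + \<rho> + 2 * d + 2 * s2"
  \<comment> \<open>A finite part is required for every \<open>s > 0\<close>, and
    \<open>s + d \<le> R\<close> forces the cutoff to grow with large \<open>s\<close>; for
    \<open>s \<le> \<rho>\<close> it is the constant \<open>R0\<close>, so the limit is
    unaffected.\<close>
  define H where "H s = (LINT x|lborel. indicator {s<..} (r1 x) * K (R0 + max 0 (s - \<rho>)) x)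
     + solid_angle_integral (f2 (-3)) * ln ((R0 + max 0 (s - \<rho>)) / s2)" for s
  have d0: "d \<ge> 0" by simp
  have "has_FP_integral {x. norm (x - y1) > s} y1 s2 (subtract_singular y2 A2 f2 F) (of_real (H s))" if "s > 0" for s
    unfolding H_def
    by (rule has_FP_integral_subtract_singular[OF that s2]) (use \<rho> s2 d0 in \<open>auto simp: R0_def\<close>)
  moreover have "((\<lambda>s. H s + Pf_counterterm A1 f1 s1 s) \<longlongrightarrow> regular_value s1 s2) (at_right 0)"
  proof (rule Lim_transform_eventually[OF tendsto_outside_integral_K[OF s1 s2, of R0]])
    show "\<rho> \<le> R0" using \<rho> s2 d0 by (simp add: R0_def)
    show "\<forall>\<^sub>F s in at_right 0. (LINT x|lborel. indicator {s<..} (r1 x) * K R0 x)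
        + solid_angle_integral (f2 (-3)) * ln (R0 / s2) + Pf_counterterm A1 f1 s1 s = H s + Pf_counterterm A1 f1 s1 s"
      by (rule eventually_at_rightI[of 0 \<rho>]) (use \<rho> in \<open>auto simp: H_def\<close>)
  qed
  then have "((\<lambda>s. complex_of_real (H s) + complex_of_real (Pf_counterterm A1 f1 s1 s))
      \<longlongrightarrow> of_real (regular_value s1 s2)) (at_right 0)"
    unfolding of_real_add[symmetric] by (rule tendsto_of_real)
  ultimately show ?thesis
    unfolding has_Pf_FP_def by (intro exI[of _ "\<lambda>s. of_real (H s)"]) auto
qed

end

theorem proposition1:
  fixes y1 y2 :: "real^3"
    and F :: "real^3 \<Rightarrow> real"
    and A1 A2 :: "real set"
    and f1 f2 :: "real \<Rightarrow> real^3 \<Rightarrow> real"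
    and s1 s2 \<epsilon> :: real
  assumes "y1 \<noteq> y2"
    and "class_F y1 y2 A1 f1 A2 f2 F"
    and "\<epsilon> > 0"
    and "F \<in> O[at_infinity](\<lambda>x. norm x powr (- 3 - \<epsilon>))"
    and "s1 > 0" and "s2 > 0"
  shows "\<exists>L::real.
           has_Pf y1 y2 A1 f1 A2 f2 s1 s2 F L \<and>
           has_Pf_FP y1 A1 f1 s1 s2 (subtract_singular y2 A2 f2 F) (complex_of_real L)"
proof -
  have exp: "has_radial_expansion F y1 A1 f1" "has_radial_expansion F y2 A2 f2"
    and "Ck_on 0 (- {y1, y2}) F"
    using assms(2) by (auto simp: class_F_def smooth_on_def)
  then have cont: "continuous_on (- {y1, y2}) F" by simp
  obtain \<delta>1 where \<delta>1: "\<delta>1 > 0" "\<And>x. 0 < norm (x - y1) \<Longrightarrow> norm (x - y1) < \<delta>1 \<Longrightarrow>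
       \<bar>F x - (\<Sum>a\<in>{a\<in>A1. a \<le> 0}. norm (x - y1) powr a * f1 a (sgn (x - y1)))\<bar> \<le> 1"
    by (rule has_radial_expansion_near[OF exp(1)]) (rule that, assumption, blast)
  obtain \<delta>2 where \<delta>2: "\<delta>2 > 0" "\<And>x. 0 < norm (x - y2) \<Longrightarrow> norm (x - y2) < \<delta>2 \<Longrightarrow>
       \<bar>F x - (\<Sum>a\<in>{a\<in>A2. a \<le> 0}. norm (x - y2) powr a * f2 a (sgn (x - y2)))\<bar> \<le> 1"
    by (rule has_radial_expansion_near[OF exp(2)]) (rule that, assumption, blast)
  \<comment> \<open>A third makes \<open>2 * \<rho> < norm (y1 - y2)\<close> strict and puts the
    closed balls of radius \<open>\<rho>\<close> inside the open ones of radii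
    \<open>\<delta>1\<close> and \<open>\<delta>2\<close>.\<close>
  define \<rho> where "\<rho> = min (norm (y1 - y2)) (min \<delta>1 \<delta>2) / 3"
  have d: "norm (y1 - y2) > 0" using assms(1) by simp
  have \<rho>: "\<rho> > 0" "2 * \<rho> < norm (y1 - y2)" "\<rho> < \<delta>1" "\<rho> < \<delta>2"
    using d \<delta>1(1) \<delta>2(1) unfolding \<rho>_def by (auto simp: min_def)
  interpret two_centres y1 y2 F A1 A2 f1 f2 \<epsilon> \<rho>
    by unfold_locales (use exp cont assms(3,4) \<rho> \<delta>1 \<delta>2 in auto)
  show ?thesis
    using has_Pf[OF assms(5,6)] has_Pf_FP[OF assms(5,6)] by blast
qed

end
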